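(* For every integer $n>1$, $\det G_{n-1}$ divides $\det G_n$ in the ring $R=\mathbb{Z}[d,x_1,x_2,y_1,y_2,z_1,z_2,z_3]$.
   Context: Diagrams. For $n\ge 1$, consider the closed unit disk $D^2$ with two labelled holes $X_1,Y_1$ in its interior and $2n$ marked points $a_0,\dots,a_{2n-1}$ arranged counter-clockwise on the outer boundary circle. $\mathbf{B}_n$ is the set of diagrams consisting of $n$ non-crossing chords (disjoint arcs in the disk with two holes) connecting the $2n$ points in pairs, up to the following equivalence: two diagrams are equivalent iff filling in the holes gives the same crossingless chord diagram in the disk (the underlying Catalan state $\gamma(b)$) and the labelled holes $X_1,Y_1$ are distributed in the same way among the $n+1$ regions into which the chords cut the disk. Thus an element of $\mathbf{B}_n$ is a non-crossing perfect matching of $a_0,\dots,a_{2n-1}$ together with an assignment of each of $X_1,Y_1$ to one of the $n+1$ regions, and $|\mathbf{B}_n|=(n+1)\binom{2n}{n}$. Pairing. For $b_j\in\mathbf{B}_n$ let $b_j^*$ be its image under the inversion $z\mapsto z/|z|^2$ of the sphere $\mathbb{C}\cup\{\infty\}$; it lies outside the unit disk, and the images of the holes $X_1,Y_1$ are denoted $X_2,Y_2$. Gluing $b_i$ with $b_j^*$ along the unit circle (matching the marked points) gives a diagram $b_i\circ b_j^*$ of at most $n$ disjoint closed curves on the sphere with four holes $X_1,Y_1$ (coming from $b_i$) and $X_2,Y_2$ (coming from $b_j^*$). Each closed curve splits $\{X_1,X_2,Y_1,Y_2\}$ into two (possibly empty) sides and is assigned a variable: $d$ if all four holes are on one side; $x_1,x_2,y_1,y_2$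 if it separates, respectively, $X_1$, $X_2$, $Y_1$, $Y_2$ from the other three; $z_1$ if it separates $\{X_1,X_2\}$ from $\{Y_1,Y_2\}$; $z_2$ if it separates $\{X_1,Y_1\}$ from $\{X_2,Y_2\}$; $z_3$ if it separates $\{X_1,Y_2\}$ from $\{X_2,Y_1\}$. Then $\langle b_i,b_j\rangle\in R=\mathbb{Z}[d,x_1,x_2,y_1,y_2,z_1,z_2,z_3]$ is the product of the variables of all closed curves of $b_i\circ b_j^*$. Gram matrix. $G_n=(\langle b_i,b_j\rangle)_{b_i,b_j\in\mathbf{B}_n}$, with the same ordering of $\mathbf{B}_n$ used for rows and columns. *)

theory Defs
  imports
    "HOL-Library.Poly_Mapping"
    "HOL-Library.Disjoint_Sets"
    "Jordan_Normal_Form.Determinant"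
begin

(* The marked point a_k on the circle is represented by the number k < 2n. "Gap k" is the open
   arc of the circle that runs counter-clockwise from a_k to a_(k+1), indices mod 2n.
   All definitions are meant for n >= 1. *)

definition noncrossing_matching :: "nat \<Rightarrow> nat set set \<Rightarrow> bool" where
  "noncrossing_matching n M \<longleftrightarrow>
     partition_on {..<2 * n} M \<and> (\<forall>c\<in>M. card c = 2) \<and>
     \<not> (\<exists>i j k l. {i, k} \<in> M \<and> {j, l} \<in> M \<and> i < j \<and> j < k \<and> k < l)"

(* The chord {p, q} with p < q cuts the disk into two halves: one is bounded by the gaps
   p, ..., q - 1, the other one by the remaining gaps. *)
definition separates :: "nat set \<Rightarrow> nat \<Rightarrow> nat \<Rightarrow> bool" where
  "separates c k l \<longleftrightarrow> (k \<in> {Min c..<Max c}) \<noteq> (l \<in> {Min c..<Max c})"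

(* Two gaps are joined if they border the same component of the disk cut along the chords in M. *)
definition joined :: "nat \<Rightarrow> nat set set \<Rightarrow> (nat \<times> nat) set" where
  "joined n M = {(k, l). k < 2 * n \<and> l < 2 * n \<and> (\<forall>c\<in>M. \<not> separates c k l)}"

(* Every region of the cut disk borders the circle (as n >= 1), so it is determined by the set of
   gaps that it borders, and it is identified with this set. *)
definition regions :: "nat \<Rightarrow> nat set set \<Rightarrow> nat set set" where
  "regions n M = {..<2 * n} // joined n M"

record diagram =
  chords :: "nat set set"
  region_X :: "nat set"
  region_Y :: "nat set"

definition diagrams :: "nat \<Rightarrow> diagram set" where
  "diagrams n = {b. noncrossing_matching n (chords b) \<and>
     region_X b \<in> regions n (chords b) \<and> region_Y b \<in> regions n (chords b)}"

(* The inversion fixes the unit circle pointwise. So the image of a diagram has the same data as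
   the diagram itself, with the chords and the holes read outside of the disk. A closed curve of
   the glued diagram is represented by the set of marked points that it passes through; it
   consists of the chords of both diagrams that have their ends in this set. *)
definition curves :: "nat \<Rightarrow> diagram \<Rightarrow> diagram \<Rightarrow> nat set set" where
  "curves n b b' = {..<2 * n} // {(p, q). \<exists>c \<in> chords b \<union> chords b'. p \<in> c \<and> q \<in> c}\<^sup>+"

(* Two gaps are related if they lie in the same component of the sphere minus the curve C: this
   complement is obtained from the inner and the outer disk, each cut along its chords in C, by
   gluing them along the circle without the points of C. *)
definition same_side :: "nat \<Rightarrow> diagram \<Rightarrow> diagram \<Rightarrow> nat set \<Rightarrow> (nat \<times> nat) set" where
  "same_side n b b' C =
     (joined n {c \<in> chords b. c \<subseteq> C} \<union> joined n {c \<in> chords b'. c \<subseteq> C})\<^sup>+"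

datatype hole = X1 | X2 | Y1 | Y2

fun hole_region :: "diagram \<Rightarrow> diagram \<Rightarrow> hole \<Rightarrow> nat set" where
  "hole_region b b' X1 = region_X b"
| "hole_region b b' Y1 = region_Y b"
| "hole_region b b' X2 = region_X b'"
| "hole_region b b' Y2 = region_Y b'"

(* The choice of the gaps k and l does not matter: a region lies on one side of each curve. *)
definition holes_same_side ::
    "nat \<Rightarrow> diagram \<Rightarrow> diagram \<Rightarrow> nat set \<Rightarrow> hole \<Rightarrow> hole \<Rightarrow> bool" where
  "holes_same_side n b b' C h h' \<longleftrightarrow>
     (\<exists>k \<in> hole_region b b' h. \<exists>l \<in> hole_region b b' h'. (k, l) \<in> same_side n b b' C)"

datatype indet = Ind_d | Ind_x1 | Ind_x2 | Ind_y1 | Ind_y2 | Ind_z1 | Ind_z2 | Ind_z3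

fun one_side :: "indet \<Rightarrow> hole set" where
  "one_side Ind_d = {}"
| "one_side Ind_x1 = {X1}"
| "one_side Ind_x2 = {X2}"
| "one_side Ind_y1 = {Y1}"
| "one_side Ind_y2 = {Y2}"
| "one_side Ind_z1 = {X1, X2}"
| "one_side Ind_z2 = {X1, Y1}"
| "one_side Ind_z3 = {X1, Y2}"

(* The variable whose split into one_side v and its complement is the one made by the curve C.
   It exists and is unique since a closed curve has exactly two sides and the sets one_side v
   represent each of the 8 splits of the 4 holes once. *)
definition curve_indet :: "nat \<Rightarrow> diagram \<Rightarrow> diagram \<Rightarrow> nat set \<Rightarrow> indet" where
  "curve_indet n b b' C =
     (THE v. \<forall>h h'. holes_same_side n b b' C h h' \<longleftrightarrow> (h \<in> one_side v \<longleftrightarrow> h' \<in> one_side v))"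

(* The polynomial ring over the integers in the variables from indet. *)
type_synonym R = "(indet \<Rightarrow>\<^sub>0 nat) \<Rightarrow>\<^sub>0 int"

definition var :: "indet \<Rightarrow> R" where
  "var v = Poly_Mapping.single (Poly_Mapping.single v 1) 1"

definition pairing :: "nat \<Rightarrow> diagram \<Rightarrow> diagram \<Rightarrow> R" where
  "pairing n b b' = (\<Prod>C \<in> curves n b b'. var (curve_indet n b b' C))"

definition is_ordering :: "nat \<Rightarrow> diagram list \<Rightarrow> bool" where
  "is_ordering n bs \<longleftrightarrow> distinct bs \<and> set bs = diagrams n"

definition gram :: "nat \<Rightarrow> diagram list \<Rightarrow> R mat" where
  "gram n bs = mat (length bs) (length bs) (\<lambda>(i, j). pairing n (bs ! i) (bs ! j))"

lemma finite_diagrams: "finite (diagrams n)"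
proof -
  have reg: "r \<subseteq> {..<2 * n}" if "r \<in> regions n M" for r M
    using that by (auto simp: regions_def quotient_def joined_def)
  have "diagrams n \<subseteq> (\<lambda>(M, r, s). \<lparr>chords = M, region_X = r, region_Y = s\<rparr>) `
      (Pow (Pow {..<2 * n}) \<times> Pow {..<2 * n} \<times> Pow {..<2 * n})"
  proof
    fix b assume b: "b \<in> diagrams n"
    then have "chords b \<subseteq> Pow {..<2 * n}"
      by (auto simp: diagrams_def noncrossing_matching_def partition_on_def)
    moreover have "region_X b \<subseteq> {..<2 * n}" "region_Y b \<subseteq> {..<2 * n}"
      using b reg by (auto simp: diagrams_def)
    ultimately show "b \<in> (\<lambda>(M, r, s). \<lparr>chords = M, region_X = r, region_Y = s\<rparr>) `
      (Pow (Pow {..<2 * n}) \<times> Pow {..<2 * n} \<times> Pow {..<2 * n})"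
      by (intro image_eqI[where x = "(chords b, region_X b, region_Y b)"]) auto
  qed
  then show ?thesis by (rule finite_subset) auto
qed

lemma ex_ordering: "\<exists>bs. is_ordering n bs"
  unfolding is_ordering_def using finite_distinct_list[OF finite_diagrams] by blast

end

theory Submission
  imports Defs
begin

text \<open>
  Adding to a diagram \<open>b\<close> with \<open>n - 1\<close> chords an outermost chord that cuts off no hole embeds the
  smaller diagrams into the larger ones. In the gluing of such a diagram with \<open>b'\<^sup>*\<close>, the
  new chord acts as a cap on two neighbouring points of \<open>b'\<close>: either \<open>b'\<close> has a chord there, and the cap
  closes it to a curve whose variable depends on \<open>b'\<close> only, or the cap bends two chords of \<open>b'\<close> into one.
  In both cases the pairing is a multiple, with a factor depending on \<open>b'\<close> only, of the pairing of
  \<open>b\<close> with a smaller diagram. So the rows of \<open>G\<^sub>n\<close> that belong to the embedded diagrams form a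
  product \<open>G\<^bsub>n-1\<^esub> P\<close>, and \<open>det G\<^bsub>n-1\<^esub>\<close> splits off.
\<close>

section \<open>Determinants of matrices with a factor in some rows\<close>

text \<open>The smaller diagram and the factor must not depend on \<open>b\<close>: only then is
  column \<open>b'\<close> of the selected rows a multiple of one single column of the smaller Gram
  matrix. The obstacle is that capping \<open>b'\<close> loses a gap of the circle in which holes of
  \<open>b'\<close> may sit, so it has to be settled where these go. If \<open>b'\<close> has the
  chord at the cap, they drop into the region around it, and the lost curve has the variable
  \<open>d\<close>, \<open>x2\<close>, \<open>y2\<close> or \<open>z2\<close>, according to which of
  \<open>X2\<close>, \<open>Y2\<close> the chord cuts off. If two chords are bent into one, the gap
  lies in the strip between them, and the strip becomes one side of the bent chord. Curves and their
  sides are given by transitive closures of relations on points and gaps. Isotopies are therefore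
  replaced by retractions of the larger set of points or gaps onto the smaller one, along which the
  closures correspond. Variables are compared through the splits of the holes: if these agree, so do
  the two \<open>THE\<close> terms. The cap sits at the last two points so that all other points
  keep their numbers.\<close>

lemma det_four_block_mat_one:
  fixes G :: "'a :: comm_ring_1 mat"
  assumes G: "G \<in> carrier_mat k k"
  shows "det (four_block_mat G (0\<^sub>m k m) (0\<^sub>m m k) (1\<^sub>m m)) = det G"
proof (induction m)
  case 0
  have "four_block_mat G (0\<^sub>m k 0) (0\<^sub>m 0 k) (1\<^sub>m 0) = G"
    using G by (intro eq_matI) auto
  then show ?case by simp
next
  case (Suc m)
  let ?M = "\<lambda>m. four_block_mat G (0\<^sub>m k m) (0\<^sub>m m k) (1\<^sub>m m)"
  have "?M (Suc m) = four_block_mat (?M m) (0\<^sub>m (k + m) 1) (0\<^sub>m 1 (k + m)) (1\<^sub>m 1)"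
    using G by (intro eq_matI) auto
  moreover have "?M m \<in> carrier_mat (k + m) (k + m)"
    using G by auto
  ultimately show ?case
    using Suc det_four_block_mat_upper_right_zero_col[of "?M m" "k + m" "0\<^sub>m (k + m) 1"]
    by simp
qed

text \<open>Used to move the selected rows to the top. The complements of domain and image have the
  same size, so any bijection between them completes \<open>f\<close>.\<close>

lemma inj_extends_to_permutation:
  fixes f :: "nat \<Rightarrow> nat"
  assumes inj: "inj_on f {..<k}" and im: "f ` {..<k} \<subseteq> {..<N}"
  obtains p where "p permutes {..<N}" "\<And>i. i < k \<Longrightarrow> p i = f i"
proof -
  have "k \<le> N"
    using card_mono[OF _ im] card_image[OF inj] by simp
  then have "card ({..<N} - {..<k}) = card ({..<N} - f ` {..<k})"
    using im card_image[OF inj] by (simp add: card_Diff_subset)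
  then obtain g where g: "bij_betw g ({..<N} - {..<k}) ({..<N} - f ` {..<k})"
    by (metis finite_Diff finite_lessThan finite_same_card_bij)
  define p where "p i = (if i < k then f i else if i < N then g i else i)" for i
  have "bij_betw p {..<k} (f ` {..<k})"
    using inj by (simp add: bij_betw_def p_def inj_on_def)
  moreover have "bij_betw p ({..<N} - {..<k}) ({..<N} - f ` {..<k})"
    using g by (rule bij_betw_cong[THEN iffD1, rotated]) (auto simp: p_def)
  ultimately have "bij_betw p ({..<k} \<union> ({..<N} - {..<k})) (f ` {..<k} \<union> ({..<N} - f ` {..<k}))"
    by (rule bij_betw_combine) auto
  moreover have "{..<k} \<union> ({..<N} - {..<k}) = {..<N}" "f ` {..<k} \<union> ({..<N} - f ` {..<k}) = {..<N}"
    using im \<open>k \<le> N\<close> by auto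
  ultimately have "p permutes {..<N}"
    using \<open>k \<le> N\<close> by (intro bij_imp_permutes) (auto simp: p_def)
  then show thesis by (rule that) (simp add: p_def)
qed

text \<open>Once the rows \<open>f i\<close> are on top, the matrix is a block diagonal matrix with
  blocks \<open>G\<close> and 1, times the matrix with \<open>P\<close> above the untouched rows.
  The determinant is multiplicative, and the permutation of the rows costs only a sign.\<close>

lemma det_dvd_det_if_rows_factor:
  fixes A G P :: "'a :: comm_ring_1 mat"
  assumes A: "A \<in> carrier_mat N N" and G: "G \<in> carrier_mat k k" and P: "P \<in> carrier_mat k N"
    and inj: "inj_on f {..<k}" and im: "f ` {..<k} \<subseteq> {..<N}"
    and rows: "\<And>i j. i < k \<Longrightarrow> j < N \<Longrightarrow> A $$ (f i, j) = (G * P) $$ (i, j)"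
  shows "det G dvd det A"
proof -
  obtain p where p: "p permutes {..<N}" and pf: "\<And>i. i < k \<Longrightarrow> p i = f i"
    using inj_extends_to_permutation[OF inj im] by blast
  have "k \<le> N"
    using card_mono[OF _ im] card_image[OF inj] by simp
  then obtain m where N: "N = k + m" using le_Suc_ex by blast
  define A' where "A' = mat N N (\<lambda>(i, j). A $$ (p i, j))"
  define C where "C = mat m N (\<lambda>(i, j). A' $$ (k + i, j))"
  define M where "M = four_block_mat G (0\<^sub>m k m) (0\<^sub>m m k) (1\<^sub>m m)"
  \<comment> \<open>The blocks of width 0 let \<open>four_block_mat\<close> stack \<open>P\<close>
    on \<open>C\<close>, so that the block multiplication rule applies.\<close>
  define B where "B = four_block_mat P (0\<^sub>m k 0) C (0\<^sub>m m 0)"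
  have C: "C \<in> carrier_mat m N" by (simp add: C_def)
  have "M * B = four_block_mat (G * P + 0\<^sub>m k m * C) (G * 0\<^sub>m k 0 + 0\<^sub>m k m * 0\<^sub>m m 0)
      (0\<^sub>m m k * P + 1\<^sub>m m * C) (0\<^sub>m m k * 0\<^sub>m k 0 + 1\<^sub>m m * 0\<^sub>m m 0)"
    unfolding M_def B_def by (rule mult_four_block_mat) (use G P C in auto)
  also have "\<dots> = four_block_mat (G * P) (0\<^sub>m k 0) C (0\<^sub>m m 0)"
    using G P C by simp
  also have "\<dots> = A'"
    using G P C by (intro eq_matI) (auto simp: A'_def C_def N pf rows)
  finally have "det A' = det M * det B"
    by (subst det_mult[of M N B, symmetric]) (use G P C in \<open>auto simp: M_def B_def N\<close>)
  also have "det M = det G"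
    unfolding M_def using G by (rule det_four_block_mat_one)
  finally have "det G dvd det A'" by simp
  moreover have "det A' = signof p * det A"
    unfolding A'_def using A p by (intro det_permute_rows) (simp_all add: atLeast0LessThan)
  then have "det A = signof p * det A'"
    by (auto simp: sign_def)
  ultimately show ?thesis by simp
qed

section \<open>Retracts of relations\<close>

text \<open>Steps of \<open>R\<close> become paths of \<open>Q\<close>, steps of \<open>Q\<close>
  are paths of \<open>R\<close>, and \<open>R\<close> links each element to its retract. This serves
  both for points, to compare curves, and for gaps, to compare the sides of a curve.\<close>

lemma trancl_iff_retract:
  assumes R_Q: "\<And>k l. (k, l) \<in> R \<Longrightarrow> (\<rho> k, \<rho> l) \<in> Q\<^sup>+"
    and Q_R: "\<And>k l. (k, l) \<in> Q \<Longrightarrow> (k, l) \<in> R\<^sup>+"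
    and retract: "\<And>k. k \<in> A \<Longrightarrow> (k, \<rho> k) \<in> R\<^sup>+"
    and sym: "sym R" and "k \<in> A" "l \<in> A"
  shows "(k, l) \<in> R\<^sup>+ \<longleftrightarrow> (\<rho> k, \<rho> l) \<in> Q\<^sup>+"
proof
  assume "(k, l) \<in> R\<^sup>+"
  then show "(\<rho> k, \<rho> l) \<in> Q\<^sup>+"
    by (induction rule: trancl_induct) (blast intro: R_Q trancl_trans)+
next
  assume "(\<rho> k, \<rho> l) \<in> Q\<^sup>+"
  then have "(\<rho> k, \<rho> l) \<in> R\<^sup>+"
    by (induction rule: trancl_induct) (blast intro: Q_R trancl_trans)+
  moreover have "(\<rho> l, l) \<in> R\<^sup>+"
    using retract[OF \<open>l \<in> A\<close>] sym_trancl[OF sym] by (meson symD)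
  ultimately show "(k, l) \<in> R\<^sup>+"
    using retract[OF \<open>k \<in> A\<close>] by (meson trancl_trans)
qed

text \<open>Intersecting with \<open>B\<close> undoes the preimage because \<sigma> fixes
  \<open>B\<close>; the preimage of the class of \<open>\<sigma> x\<close> is the class of
  \<open>x\<close>.\<close>

lemma quotient_retract:
  assumes A: "equiv A R" and B: "equiv B Q" and "B \<subseteq> A" and \<sigma>: "\<sigma> ` A \<subseteq> B"
    and \<sigma>_id: "\<And>x. x \<in> B \<Longrightarrow> \<sigma> x = x"
    and iff: "\<And>x y. x \<in> A \<Longrightarrow> y \<in> A \<Longrightarrow> (x, y) \<in> R \<longleftrightarrow> (\<sigma> x, \<sigma> y) \<in> Q"
  shows "bij_betw (\<lambda>C. {x \<in> A. \<sigma> x \<in> C}) (B // Q) (A // R)"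
proof -
  let ?pre = "\<lambda>C. {x \<in> A. \<sigma> x \<in> C}"
  have pre: "?pre (Q `` {\<sigma> x}) = R `` {x}" if "x \<in> A" for x
    using iff that equiv_type[OF A] by auto
  have "inj_on ?pre (B // Q)"
  proof (rule inj_onI)
    fix C D
    assume C: "C \<in> B // Q" and D: "D \<in> B // Q" and eq: "?pre C = ?pre D"
    have "C \<subseteq> B" "D \<subseteq> B"
      using C D equiv_type[OF B] by (auto simp: quotient_def)
    moreover have "?pre C \<inter> B = C \<inter> B" "?pre D \<inter> B = D \<inter> B"
      using \<open>B \<subseteq> A\<close> by (auto simp: \<sigma>_id)
    ultimately show "C = D" using eq by blast
  qed
  moreover have "?pre ` (B // Q) = A // R"
  proof (intro equalityI subsetI)
    fix D assume "D \<in> ?pre ` (B // Q)"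
    then obtain x where "x \<in> B" "D = ?pre (Q `` {x})"
      by (auto elim!: quotientE)
    then have "x \<in> A" "D = R `` {x}"
      using pre[of x] \<sigma>_id \<open>B \<subseteq> A\<close> by auto
    then show "D \<in> A // R" by (simp add: quotientI)
  next
    fix D assume "D \<in> A // R"
    then obtain x where "x \<in> A" "D = R `` {x}" by (auto elim!: quotientE)
    then have "D = ?pre (Q `` {\<sigma> x})" "Q `` {\<sigma> x} \<in> B // Q"
      using pre \<sigma> by (auto intro: quotientI)
    then show "D \<in> ?pre ` (B // Q)" by blast
  qed
  ultimately show ?thesis by (simp add: bij_betw_def)
qed

section \<open>Matchings, regions and curves\<close>

lemma noncrossing_matching_iff:
  "noncrossing_matching n M \<longleftrightarrow>
     (\<forall>c\<in>M. \<exists>a b. c = {a, b} \<and> a < b \<and> b < 2 * n) \<and>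
     (\<forall>p<2 * n. \<exists>c\<in>M. p \<in> c) \<and>
     (\<forall>c\<in>M. \<forall>c'\<in>M. \<forall>p. p \<in> c \<longrightarrow> p \<in> c' \<longrightarrow> c = c') \<and>
     (\<forall>i j k l. {i, k} \<in> M \<longrightarrow> {j, l} \<in> M \<longrightarrow> i < j \<longrightarrow> j < k \<longrightarrow> \<not> k < l)"
  (is "_ \<longleftrightarrow> ?pairs \<and> ?cover \<and> ?disj \<and> ?nc")
proof -
  have "partition_on {..<2 * n} M \<and> (\<forall>c\<in>M. card c = 2) \<longleftrightarrow> ?pairs \<and> ?cover \<and> ?disj"
  proof
    assume P: "partition_on {..<2 * n} M \<and> (\<forall>c\<in>M. card c = 2)"
    have ?pairs
    proof
      fix c assume "c \<in> M"
      then obtain a b where "c = {a, b}" "a \<noteq> b"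
        using P by (meson card_2_iff)
      moreover have "c \<subseteq> {..<2 * n}"
        using P \<open>c \<in> M\<close> by (auto simp: partition_on_def)
      ultimately have "c = {a, b}" "a \<noteq> b" "a < 2 * n" "b < 2 * n" by auto
      then show "\<exists>a b. c = {a, b} \<and> a < b \<and> b < 2 * n"
        by (metis insert_commute linorder_neqE_nat)
    qed
    moreover have ?cover using P by (auto simp: partition_on_def)
    moreover have ?disj
    proof (intro ballI allI impI)
      fix c c' p assume "c \<in> M" "c' \<in> M" "p \<in> c" "p \<in> c'"
      moreover have "disjoint M" using P by (simp add: partition_on_def)
      ultimately show "c = c'" using disjointD by blast
    qed
    ultimately show "?pairs \<and> ?cover \<and> ?disj" by (intro conjI)
  next
    assume P: "?pairs \<and> ?cover \<and> ?disj"
    have pair: "\<exists>a b. c = {a, b} \<and> a < b \<and> b < 2 * n" if "c \<in> M" for c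
      using P that by blast
    have "\<Union>M = {..<2 * n}"
    proof (intro equalityI subsetI)
      fix p assume "p \<in> \<Union>M"
      then obtain c where "c \<in> M" "p \<in> c" by blast
      then show "p \<in> {..<2 * n}" using pair[of c] by auto
    next
      fix p assume "p \<in> {..<2 * n}"
      then show "p \<in> \<Union>M" using P by auto
    qed
    moreover have "disjoint M"
    proof (rule disjointI)
      fix c c' assume "c \<in> M" "c' \<in> M" "c \<noteq> c'"
      then show "c \<inter> c' = {}" using P by blast
    qed
    moreover have card: "card c = 2" if "c \<in> M" for c
      using pair[OF that] by auto
    moreover have "{} \<notin> M" using card[of "{}"] by auto
    ultimately show "partition_on {..<2 * n} M \<and> (\<forall>c\<in>M. card c = 2)"
      by (auto simp: partition_on_def)
  qed
  moreover have "\<not> (\<exists>i j k l. {i, k} \<in> M \<and> {j, l} \<in> M \<and> i < j \<and> j < k \<and> k < l) \<longleftrightarrow> ?nc"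
    by blast
  ultimately show ?thesis unfolding noncrossing_matching_def by argo
qed

lemma noncrossing_matching_chord:
  assumes "noncrossing_matching n M" "c \<in> M"
  obtains a b where "c = {a, b}" "a < b" "b < 2 * n"
  using assms by (auto simp: noncrossing_matching_iff)

lemma noncrossing_matching_ex_chord:
  assumes "noncrossing_matching n M" "p < 2 * n"
  obtains q where "{p, q} \<in> M" "q < 2 * n" "q \<noteq> p"
proof -
  obtain c where "c \<in> M" "p \<in> c"
    using assms by (auto simp: noncrossing_matching_iff)
  moreover from this obtain a b where "c = {a, b}" "a < b" "b < 2 * n"
    using assms(1) noncrossing_matching_chord by metis
  ultimately show thesis
    using that[of a] that[of b] by (auto simp: insert_commute)
qed

lemma noncrossing_matching_unique:
  assumes "noncrossing_matching n M" "c \<in> M" "c' \<in> M" "p \<in> c" "p \<in> c'"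
  shows "c = c'"
  using assms unfolding noncrossing_matching_iff by metis

lemma noncrossing_matching_no_crossing:
  assumes "noncrossing_matching n M" "{i, k} \<in> M" "{j, l} \<in> M" "i < j" "j < k"
  shows "\<not> k < l"
  using assms unfolding noncrossing_matching_iff by metis

lemma separates_pair:
  assumes "a < b"
  shows "separates {a, b} k l \<longleftrightarrow> (a \<le> k \<and> k < b) \<noteq> (a \<le> l \<and> l < b)"
  using assms by (simp add: separates_def)

lemma joined_iff:
  "(k, l) \<in> joined n K \<longleftrightarrow> k < 2 * n \<and> l < 2 * n \<and> (\<forall>c\<in>K. \<not> separates c k l)"
  by (simp add: joined_def)

lemma joined_insert:
  "(k, l) \<in> joined n (insert c K) \<longleftrightarrow> (k, l) \<in> joined n K \<and> \<not> separates c k l"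
  by (auto simp: joined_def)

lemma equiv_joined: "equiv {..<2 * n} (joined n K)"
  by (intro equivI refl_onI symI transI) (auto simp: joined_def separates_def)

lemma joined_refl: "k < 2 * n \<Longrightarrow> (k, k) \<in> joined n K"
  by (simp add: joined_def separates_def)

lemma joined_sym: "(k, l) \<in> joined n K \<Longrightarrow> (l, k) \<in> joined n K"
  by (auto simp: joined_def separates_def)

lemma joined_trans: "(k, l) \<in> joined n K \<Longrightarrow> (l, p) \<in> joined n K \<Longrightarrow> (k, p) \<in> joined n K"
  by (auto simp: joined_def separates_def)

lemma equiv_trancl:
  assumes "R \<subseteq> A \<times> A" "sym R" "\<And>x. x \<in> A \<Longrightarrow> (x, x) \<in> R"
  shows "equiv A (R\<^sup>+)"
  using assms trancl_subset_Sigma[OF assms(1)]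
  by (intro equivI refl_onI sym_trancl trans_trancl) auto

lemma sym_joined_Un: "sym (joined n K \<union> joined n L)"
  by (intro symI) (auto dest: joined_sym)

lemma equiv_joined_Un: "equiv {..<2 * n} ((joined n K \<union> joined n L)\<^sup>+)"
proof (rule equiv_trancl)
  show "joined n K \<union> joined n L \<subseteq> {..<2 * n} \<times> {..<2 * n}"
    by (auto simp: joined_iff)
  show "(k, k) \<in> joined n K \<union> joined n L" if "k \<in> {..<2 * n}" for k
    using that by (simp add: joined_refl)
qed (rule sym_joined_Un)

lemma regionE:
  assumes "r \<in> regions n M"
  obtains k where "k < 2 * n" "r = joined n M `` {k}" "k \<in> r"
  using assms joined_refl[of _ n M] by (auto simp: regions_def quotient_def)

lemma joined_in_region:
  assumes "r \<in> regions n M" "k \<in> r"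
  shows "l \<in> r \<longleftrightarrow> (k, l) \<in> joined n M"
  using assms by (elim regionE) (auto intro: joined_trans joined_sym)

lemma region_less:
  assumes "r \<in> regions n M" "k \<in> r"
  shows "k < 2 * n"
  using assms joined_in_region[OF assms, of k] by (simp add: joined_iff)

definition join_points :: "nat set set \<Rightarrow> (nat \<times> nat) set" where
  "join_points E = {(p, q). \<exists>c\<in>E. p \<in> c \<and> q \<in> c}"

lemma curves_eq: "curves n b b' = {..<2 * n} // (join_points (chords b \<union> chords b'))\<^sup>+"
  by (simp add: curves_def join_points_def)

lemma sym_join_points: "sym (join_points E)"
  by (auto simp: join_points_def sym_def)

lemma join_points_insert: "join_points (insert c E) = c \<times> c \<union> join_points E"
  by (auto simp: join_points_def)

lemma equiv_join_points:
  assumes "noncrossing_matching n M" "noncrossing_matching n N"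
  shows "equiv {..<2 * n} ((join_points (M \<union> N))\<^sup>+)"
proof (rule equiv_trancl)
  have "c \<subseteq> {..<2 * n}" if "c \<in> M \<union> N" for c
    using that assms unfolding noncrossing_matching_def partition_on_def by blast
  then show "join_points (M \<union> N) \<subseteq> {..<2 * n} \<times> {..<2 * n}"
    by (auto simp: join_points_def)
  show "(x, x) \<in> join_points (M \<union> N)" if "x \<in> {..<2 * n}" for x
    using that assms(1) by (auto simp: join_points_def noncrossing_matching_iff)
qed (rule sym_join_points)

section \<open>Capped diagrams\<close>

text \<open>Gap \<open>2m - 1\<close> of the smaller diagram, which runs from the last point to point \<open>0\<close>, becomes the
  gaps \<open>2m - 1\<close> and \<open>2m + 1\<close>, joined around the new chord; gap \<open>2m\<close> is the one cut off by it.\<close>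

definition cap :: "nat \<Rightarrow> nat set" where
  "cap m = {2 * m, 2 * m + 1}"

text \<open>A region that contains gap \<open>2m - 1\<close> has to gain gap \<open>2m + 1\<close>.
  The image under the new \<open>joined\<close> relation does this without a case
  distinction.\<close>

definition add_cap :: "nat \<Rightarrow> diagram \<Rightarrow> diagram" where
  "add_cap m b = (let M = insert (cap m) (chords b) in
     \<lparr>chords = M, region_X = joined (Suc m) M `` region_X b, region_Y = joined (Suc m) M `` region_Y b\<rparr>)"

lemma chords_add_cap: "chords (add_cap m b) = insert (cap m) (chords b)"
  by (simp add: add_cap_def Let_def)

text \<open>A chord with both ends below \<open>2m\<close> has none of the gaps
  \<open>2m - 1\<close>, \<open>2m\<close>, \<open>2m + 1\<close> among those between its ends, so
  these three count as the last gap of the smaller circle.\<close>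

lemma joined_min:
  assumes m: "m > 0" and K: "\<And>c. c \<in> K \<Longrightarrow> \<exists>a b. c = {a, b} \<and> a < b \<and> b < 2 * m"
    and kl: "k < 2 * Suc m" "l < 2 * Suc m"
  shows "(k, l) \<in> joined (Suc m) K \<longleftrightarrow> (min k (2 * m - 1), min l (2 * m - 1)) \<in> joined m K"
proof -
  have "separates c k l \<longleftrightarrow> separates c (min k (2 * m - 1)) (min l (2 * m - 1))" if c: "c \<in> K" for c
  proof -
    obtain a b where "c = {a, b}" "a < b" "b < 2 * m" using K[OF c] by blast
    moreover from this have "a \<le> min p (2 * m - 1) \<and> min p (2 * m - 1) < b \<longleftrightarrow> a \<le> p \<and> p < b" for p
      by auto
    ultimately show ?thesis by (simp only: separates_pair)
  qed
  moreover have "min k (2 * m - 1) < 2 * m" "min l (2 * m - 1) < 2 * m"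
    using m by auto
  ultimately show ?thesis using kl by (auto simp: joined_iff)
qed

lemma separates_cap: "separates (cap m) k l \<longleftrightarrow> (k = 2 * m) \<noteq> (l = 2 * m)"
  by (auto simp: cap_def separates_pair)

lemma joined_less:
  assumes "m > 0" "\<And>c. c \<in> K \<Longrightarrow> \<exists>a b. c = {a, b} \<and> a < b \<and> b < 2 * m" "k < 2 * m" "l < 2 * m"
  shows "(k, l) \<in> joined (Suc m) K \<longleftrightarrow> (k, l) \<in> joined m K"
proof -
  have "min k (2 * m - 1) = k" "min l (2 * m - 1) = l" using assms(3,4) by auto
  then show ?thesis using joined_min[of m K k l] assms by simp
qed

lemma noncrossing_matching_add_cap:
  assumes M: "noncrossing_matching m M"
  shows "noncrossing_matching (Suc m) (insert (cap m) M)"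
proof -
  have less: "p < 2 * m" if "c \<in> M" "p \<in> c" for c p
    by (rule noncrossing_matching_chord[OF M \<open>c \<in> M\<close>]) (use \<open>p \<in> c\<close> in auto)
  have "\<exists>a b. c = {a, b} \<and> a < b \<and> b < 2 * Suc m" if "c \<in> insert (cap m) M" for c
    using that
  proof
    assume "c \<in> M"
    then obtain a b where "c = {a, b}" "a < b" "b < 2 * m"
      by (rule noncrossing_matching_chord[OF M])
    then show ?thesis by (intro exI[of _ a] exI[of _ b]) simp
  qed (auto simp: cap_def)
  moreover have "\<exists>c\<in>insert (cap m) M. p \<in> c" if "p < 2 * Suc m" for p
  proof (cases "p < 2 * m")
    case True
    then show ?thesis using M by (auto simp: noncrossing_matching_iff)
  next
    case False
    then have "p \<in> cap m" using that by (auto simp: cap_def)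
    then show ?thesis by blast
  qed
  moreover have "c = c'" if "c \<in> insert (cap m) M" "c' \<in> insert (cap m) M" "p \<in> c" "p \<in> c'" for c c' p
    using that noncrossing_matching_unique[OF M, of c c' p] less[of c p] less[of c' p]
    by (auto simp: cap_def)
  moreover have "\<not> k < l" if ik: "{i, k} \<in> insert (cap m) M" and jl: "{j, l} \<in> insert (cap m) M"
    and "i < j" "j < k" for i j k l
  proof
    assume "k < l"
    \<comment> \<open>A crossing chord would need an end strictly between the neighbours
      \<open>2m\<close> and \<open>2m + 1\<close>.\<close>
    have "{i, k} \<noteq> cap m" "{j, l} \<noteq> cap m"
      using \<open>i < j\<close> \<open>j < k\<close> \<open>k < l\<close> unfolding cap_def doubleton_eq_iff by presburger+
    then show False
      using ik jl \<open>i < j\<close> \<open>j < k\<close> \<open>k < l\<close> noncrossing_matching_no_crossing[OF M, of i k j l] by simp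
  qed
  ultimately show ?thesis by (simp add: noncrossing_matching_iff)
qed

locale capped =
  fixes m :: nat and M :: "nat set set"
  assumes m_pos: "m > 0" and M: "noncrossing_matching m M"
begin

lemma chord_pair: "c \<in> M \<Longrightarrow> \<exists>a b. c = {a, b} \<and> a < b \<and> b < 2 * m"
  using M by (simp add: noncrossing_matching_iff)

lemma joined_cap_less:
  "k < 2 * m \<Longrightarrow> l < 2 * m \<Longrightarrow> (k, l) \<in> joined (Suc m) (insert (cap m) M) \<longleftrightarrow> (k, l) \<in> joined m M"
  using joined_less[of m M k l, OF m_pos chord_pair] by (auto simp: joined_insert separates_cap)

text \<open>Recovering \<open>r\<close> on the old gaps makes \<open>add_cap\<close> injective; the
  absence of gap \<open>2m\<close> says that the new chord cuts off no hole; the last claim is what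
  the retraction of gaps needs.\<close>

lemma capped_region:
  assumes r: "r \<in> regions m M"
  defines "r' \<equiv> joined (Suc m) (insert (cap m) M) `` r"
  shows "r' \<in> regions (Suc m) (insert (cap m) M)" and "r' \<inter> {..<2 * m} = r" and "2 * m \<notin> r'"
    and "k \<in> r' \<Longrightarrow> min k (2 * m - 1) \<in> r"
proof -
  obtain k0 where k0: "k0 < 2 * m" "r = joined m M `` {k0}" "k0 \<in> r"
    using regionE[OF r] by blast
  have "r' = joined (Suc m) (insert (cap m) M) `` {k0}"
  proof -
    have "(k0, k) \<in> joined (Suc m) (insert (cap m) M)" if "k \<in> r" for k
      using that k0 joined_cap_less[of k0 k] by (simp add: joined_iff)
    then show ?thesis
      unfolding r'_def using k0(3) by (blast intro: joined_trans)
  qed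
  then show "r' \<in> regions (Suc m) (insert (cap m) M)"
    unfolding regions_def using k0(1) by (auto intro: quotientI)
  show "r' \<inter> {..<2 * m} = r"
    unfolding \<open>r' = _\<close> k0(2) using k0(1) by (auto simp: joined_cap_less joined_iff[of _ _ m])
  show "2 * m \<notin> r'"
    unfolding \<open>r' = _\<close> using k0(1) by (auto simp: joined_insert separates_cap)
  show "min k (2 * m - 1) \<in> r" if "k \<in> r'"
  proof -
    have "(k0, k) \<in> joined (Suc m) M" using that by (simp add: \<open>r' = _\<close> joined_insert)
    then have "(min k0 (2 * m - 1), min k (2 * m - 1)) \<in> joined m M"
      using joined_min[of m M k0 k] m_pos chord_pair by (simp add: joined_iff)
    moreover have "min k0 (2 * m - 1) = k0" using k0(1) by simp
    ultimately show ?thesis by (simp add: k0(2))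
  qed
qed

end

lemma diagramsD:
  assumes "b \<in> diagrams n"
  shows "noncrossing_matching n (chords b)" "region_X b \<in> regions n (chords b)"
    "region_Y b \<in> regions n (chords b)"
  using assms by (auto simp: diagrams_def)

lemma add_cap_in_diagrams:
  assumes "m > 0" and b: "b \<in> diagrams m"
  shows "add_cap m b \<in> diagrams (Suc m)"
proof -
  interpret capped m "chords b" using assms by unfold_locales (auto dest: diagramsD)
  show ?thesis
    using diagramsD[OF b] by (simp add: add_cap_def Let_def diagrams_def noncrossing_matching_add_cap capped_region(1))
qed

lemma region_add_cap:
  assumes "m > 0" and b: "b \<in> diagrams m"
  shows "region_X (add_cap m b) \<inter> {..<2 * m} = region_X b" "region_Y (add_cap m b) \<inter> {..<2 * m} = region_Y b"
proof -
  interpret capped m "chords b" using assms by unfold_locales (auto dest: diagramsD)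
  show "region_X (add_cap m b) \<inter> {..<2 * m} = region_X b" "region_Y (add_cap m b) \<inter> {..<2 * m} = region_Y b"
    using capped_region(2)[OF diagramsD(2)[OF b]] capped_region(2)[OF diagramsD(3)[OF b]]
    by (simp_all add: add_cap_def Let_def)
qed

lemma inj_on_add_cap:
  assumes "m > 0"
  shows "inj_on (add_cap m) (diagrams m)"
proof (rule inj_onI)
  fix a b assume a: "a \<in> diagrams m" and b: "b \<in> diagrams m" and eq: "add_cap m a = add_cap m b"
  have no_cap: "cap m \<notin> chords d" if d: "d \<in> diagrams m" for d
  proof
    assume "cap m \<in> chords d"
    then obtain p q where "cap m = {p, q}" "p < q" "q < 2 * m"
      by (rule noncrossing_matching_chord[OF diagramsD(1)[OF d]])
    then show False by (auto simp: cap_def doubleton_eq_iff)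
  qed
  have "insert (cap m) (chords a) = insert (cap m) (chords b)"
    using arg_cong[OF eq, of chords] by (simp add: add_cap_def Let_def)
  then have "chords a = chords b"
    using no_cap[OF a] no_cap[OF b] by (simp add: insert_ident)
  moreover have "region_X a = region_X b" "region_Y a = region_Y b"
    using region_add_cap[OF assms a] region_add_cap[OF assms b] eq by simp_all
  ultimately show "a = b" by (simp add: diagram.equality)
qed

section \<open>Gluing the cap from the other side\<close>

text \<open>Forwards, \<rho> carries the witnesses over. Backwards, the given witnesses need not be
  values of \<rho>, so they are exchanged for such values within the same holes; this is why all
  gaps of a hole must lie on one side of \<open>C'\<close>.\<close>

lemma holes_same_side_retract:
  assumes equiv: "equiv {..<2 * m} (same_side m a a' C')"
    and ex: "\<And>h. hole_region b b' h \<noteq> {}"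
    and \<rho>: "\<And>h k. k \<in> hole_region b b' h \<Longrightarrow> k < 2 * n \<and> \<rho> k \<in> hole_region a a' h"
    and hole: "\<And>h k l. k \<in> hole_region a a' h \<Longrightarrow> l \<in> hole_region a a' h \<Longrightarrow> (k, l) \<in> same_side m a a' C'"
    and iff: "\<And>k l. k < 2 * n \<Longrightarrow> l < 2 * n \<Longrightarrow>
      (k, l) \<in> same_side n b b' C \<longleftrightarrow> (\<rho> k, \<rho> l) \<in> same_side m a a' C'"
  shows "holes_same_side n b b' C h h' \<longleftrightarrow> holes_same_side m a a' C' h h'"
proof
  assume "holes_same_side n b b' C h h'"
  then obtain k l where "k \<in> hole_region b b' h" "l \<in> hole_region b b' h'" "(k, l) \<in> same_side n b b' C"
    by (auto simp: holes_same_side_def)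
  then show "holes_same_side m a a' C' h h'"
    using iff[of k l] \<rho> unfolding holes_same_side_def by blast
next
  assume "holes_same_side m a a' C' h h'"
  then obtain k l where kl: "k \<in> hole_region a a' h" "l \<in> hole_region a a' h'" "(k, l) \<in> same_side m a a' C'"
    by (auto simp: holes_same_side_def)
  obtain k0 l0 where k0: "k0 \<in> hole_region b b' h" and l0: "l0 \<in> hole_region b b' h'"
    using ex by blast
  have "(\<rho> k0, k) \<in> same_side m a a' C'" "(l, \<rho> l0) \<in> same_side m a a' C'"
    using hole \<rho>[OF k0] \<rho>[OF l0] kl by auto
  then have "(\<rho> k0, \<rho> l0) \<in> same_side m a a' C'"
    using equiv kl(3) unfolding equiv_def by (meson transD)
  then have "(k0, l0) \<in> same_side n b b' C"
    using iff \<rho>[OF k0] \<rho>[OF l0] by blast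
  then show "holes_same_side n b b' C h h'"
    using k0 l0 unfolding holes_same_side_def by blast
qed

text \<open>After gluing the cap, gap \<open>2m\<close> of \<open>b'\<close> lies on the same sides of the remaining curves as \<open>w\<close>.
  The set \<open>N\<close> below consists of the chords into which the cap turns those of \<open>b'\<close>.\<close>

definition gap_retract :: "nat \<Rightarrow> nat \<Rightarrow> nat \<Rightarrow> nat" where
  "gap_retract m w k = (if k = 2 * m then w else min k (2 * m - 1))"

text \<open>The common part of both cases. When the chord of \<open>b'\<close> at the cap is
  deleted, \<open>w\<close> is \<open>2m - 1\<close>; when the chords from \<open>u\<close> to
  \<open>2m\<close> and from \<open>v\<close> to \<open>2m + 1\<close> are bent into one,
  \<open>w\<close> is \<open>v\<close>.\<close>

locale reduction =
  fixes m w :: nat and b' :: diagram and N :: "nat set set"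
  assumes m_pos: "m > 0" and b': "b' \<in> diagrams (Suc m)" and N: "noncrossing_matching m N"
    and w: "w < 2 * m"
    and joined_retract: "\<And>k l. (k, l) \<in> joined (Suc m) (chords b') \<Longrightarrow>
      (gap_retract m w k, gap_retract m w l) \<in> joined m N"
begin

abbreviation \<rho> :: "nat \<Rightarrow> nat" where "\<rho> \<equiv> gap_retract m w"

text \<open>Regions of \<open>b'\<close> can merge, so the retract of a region may be only a part of
  a region of \<open>N\<close>; the image under \<open>joined m N\<close> completes it.\<close>

definition reduced :: diagram where
  "reduced = \<lparr>chords = N, region_X = joined m N `` (\<rho> ` region_X b'), region_Y = joined m N `` (\<rho> ` region_Y b')\<rparr>"

lemma \<rho>_less: "\<rho> k < 2 * m"
  using w m_pos by (simp add: gap_retract_def min_less_iff_disj)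

lemma \<rho>_id: "k < 2 * m \<Longrightarrow> \<rho> k = k"
  by (simp add: gap_retract_def)

lemma reduced_region:
  assumes r: "r \<in> regions (Suc m) (chords b')"
  shows "joined m N `` (\<rho> ` r) \<in> regions m N" and "k \<in> r \<Longrightarrow> \<rho> k \<in> joined m N `` (\<rho> ` r)"
proof -
  obtain k0 where k0: "r = joined (Suc m) (chords b') `` {k0}" "k0 \<in> r"
    using regionE[OF r] by blast
  have "(\<rho> k0, \<rho> k) \<in> joined m N" if "k \<in> r" for k
    using that joined_retract by (simp add: k0(1))
  then have "joined m N `` (\<rho> ` r) = joined m N `` {\<rho> k0}"
    using k0(2) by (blast intro: joined_trans)
  then show "joined m N `` (\<rho> ` r) \<in> regions m N"
    using \<rho>_less by (auto simp: regions_def intro: quotientI)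
  show "\<rho> k \<in> joined m N `` (\<rho> ` r)" if "k \<in> r"
    using that joined_refl[OF \<rho>_less] by blast
qed

lemma reduced_in_diagrams: "reduced \<in> diagrams m"
  using diagramsD[OF b'] N by (simp add: reduced_def diagrams_def reduced_region(1))

text \<open>The retraction sends the gaps of every hole, inner or outer, into the region of the same
  hole after the reduction. Hence agreement on the sides of gaps gives the same split of the holes,
  and so the same \<open>THE\<close> term.\<close>

lemma curve_indet_reduced:
  assumes b: "b \<in> diagrams m"
    and iff: "\<And>k l. k < 2 * Suc m \<Longrightarrow> l < 2 * Suc m \<Longrightarrow>
      (k, l) \<in> same_side (Suc m) (add_cap m b) b' C \<longleftrightarrow> (\<rho> k, \<rho> l) \<in> same_side m b reduced C'"
  shows "curve_indet (Suc m) (add_cap m b) b' C = curve_indet m b reduced C'"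
proof -
  interpret capped m "chords b"
    using m_pos b by unfold_locales (auto dest: diagramsD)
  let ?H = "hole_region (add_cap m b) b'" and ?H' = "hole_region b reduced"
  let ?M = "insert (cap m) (chords b)"
  have lifted: "?H h = joined (Suc m) ?M `` ?H' h \<and> ?H' h \<in> regions m (chords b)" if "h = X1 \<or> h = Y1" for h
    using that diagramsD[OF b] by (auto simp: add_cap_def Let_def)
  have red: "?H' h = joined m N `` (\<rho> ` ?H h) \<and> ?H h \<in> regions (Suc m) (chords b')" if "h = X2 \<or> h = Y2" for h
    using that diagramsD[OF b'] by (elim disjE) (simp_all add: reduced_def)
  have region: "?H h \<in> regions (Suc m) (if h = X1 \<or> h = Y1 then ?M else chords b')" for h
    using lifted[of h] red[of h] capped_region(1)[of "?H' h"] by (cases h) auto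
  have region': "?H' h \<in> regions m (if h = X1 \<or> h = Y1 then chords b else N)" for h
    using lifted[of h] red[of h] reduced_region(1)[of "?H h"] by (cases h) auto
  have \<rho>: "k < 2 * Suc m \<and> \<rho> k \<in> ?H' h" if k: "k \<in> ?H h" for k h
  proof
    show "k < 2 * Suc m" using region_less[OF region k] by simp
    show "\<rho> k \<in> ?H' h"
    proof (cases "h = X1 \<or> h = Y1")
      case True
      \<comment> \<open>The holes of \<open>b\<close> avoid gap \<open>2m\<close>, so on their gaps
        \<rho> is \<open>min\<close>, whatever \<open>w\<close> is.\<close>
      then have "k \<noteq> 2 * m" "min k (2 * m - 1) \<in> ?H' h"
        using lifted[OF True] capped_region(3,4)[of "?H' h"] k by auto
      then show ?thesis by (simp add: gap_retract_def)
    next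
      case False
      then have "h = X2 \<or> h = Y2" by (cases h) auto
      then show ?thesis using red reduced_region(2) k by metis
    qed
  qed
  have hole: "(k, l) \<in> same_side m b reduced C'" if "k \<in> ?H' h" "l \<in> ?H' h" for h k l
  proof -
    have "(k, l) \<in> joined m (if h = X1 \<or> h = Y1 then chords b else N)"
      using joined_in_region[OF region' that(1)] that(2) by simp
    then have "(k, l) \<in> joined m {c \<in> chords b. c \<subseteq> C'} \<union> joined m {c \<in> chords reduced. c \<subseteq> C'}"
      by (auto simp: joined_iff reduced_def split: if_splits)
    then show ?thesis unfolding same_side_def by blast
  qed
  have "holes_same_side (Suc m) (add_cap m b) b' C h h' \<longleftrightarrow> holes_same_side m b reduced C' h h'" for h h'
  proof (rule holes_same_side_retract[where \<rho> = \<rho>])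
    show "equiv {..<2 * m} (same_side m b reduced C')"
      unfolding same_side_def by (rule equiv_joined_Un)
    show "?H h \<noteq> {}" for h
      using region[of h] by (auto elim!: regionE)
  qed (use \<rho> hole iff in auto)
  then show ?thesis by (simp add: curve_indet_def)
qed

text \<open>For curves that avoid the cap. All of the last three gaps then lie on one side, and by
  \<open>wK\<close> so does \<open>w\<close>; hence \<rho> and \<open>min\<close> differ only within
  a side.\<close>

lemma curve_indet_reduced_same_curve:
  assumes b: "b \<in> diagrams m" and C: "C \<subseteq> {..<2 * m}"
    and K: "{c \<in> chords b'. c \<subseteq> C} = {c \<in> N. c \<subseteq> C}"
    and wK: "(w, 2 * m - 1) \<in> joined m {c \<in> N. c \<subseteq> C}"
  shows "curve_indet (Suc m) (add_cap m b) b' C = curve_indet m b reduced C"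
proof (rule curve_indet_reduced[OF b])
  fix k l assume kl: "k < 2 * Suc m" "l < 2 * Suc m"
  interpret capped m "chords b"
    using m_pos b by unfold_locales (auto dest: diagramsD)
  interpret N: capped m N using m_pos N by unfold_locales
  define K1 where "K1 = {c \<in> chords b. c \<subseteq> C}"
  define K2 where "K2 = {c \<in> N. c \<subseteq> C}"
  let ?\<mu> = "\<lambda>k. min k (2 * m - 1)"
  have "{c \<in> chords (add_cap m b). c \<subseteq> C} = K1"
    using C by (auto simp: add_cap_def Let_def cap_def K1_def)
  then have same: "same_side (Suc m) (add_cap m b) b' C = (joined (Suc m) K1 \<union> joined (Suc m) K2)\<^sup>+"
    using K by (simp add: same_side_def K2_def)
  have same': "same_side m b reduced C = (joined m K1 \<union> joined m K2)\<^sup>+"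
    by (simp add: same_side_def reduced_def K1_def K2_def)
  have j1: "(k, l) \<in> joined (Suc m) K1 \<longleftrightarrow> (?\<mu> k, ?\<mu> l) \<in> joined m K1" if "k < 2 * Suc m" "l < 2 * Suc m" for k l
    using that m_pos by (intro joined_min) (auto simp: K1_def dest: chord_pair)
  have j2: "(k, l) \<in> joined (Suc m) K2 \<longleftrightarrow> (?\<mu> k, ?\<mu> l) \<in> joined m K2" if "k < 2 * Suc m" "l < 2 * Suc m" for k l
    using that m_pos by (intro joined_min) (auto simp: K2_def dest: N.chord_pair)
  have \<rho>\<mu>: "(\<rho> k, ?\<mu> k) \<in> joined m K2" for k
    using wK w m_pos by (auto simp: gap_retract_def K2_def intro!: joined_refl)
  have \<mu>_less: "?\<mu> k < 2 * m" for k using m_pos by auto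
  show "(k, l) \<in> same_side (Suc m) (add_cap m b) b' C \<longleftrightarrow> (\<rho> k, \<rho> l) \<in> same_side m b reduced C"
    unfolding same same'
  proof (rule trancl_iff_retract[where A = "{..<2 * Suc m}"])
    let ?Q = "joined m K1 \<union> joined m K2"
    show "(\<rho> p, \<rho> q) \<in> ?Q\<^sup>+" if pq: "(p, q) \<in> joined (Suc m) K1 \<union> joined (Suc m) K2" for p q
    proof -
      have "p < 2 * Suc m" "q < 2 * Suc m" using pq by (auto simp: joined_iff)
      then have "(?\<mu> p, ?\<mu> q) \<in> ?Q" using pq j1 j2 by blast
      moreover have "(\<rho> p, ?\<mu> p) \<in> ?Q" "(?\<mu> q, \<rho> q) \<in> ?Q"
        using \<rho>\<mu> joined_sym by blast+
      ultimately show ?thesis by (meson r_into_trancl trancl_trans)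
    qed
    show "(p, q) \<in> (joined (Suc m) K1 \<union> joined (Suc m) K2)\<^sup>+" if pq: "(p, q) \<in> ?Q" for p q
    proof -
      have "p < 2 * m" "q < 2 * m" using pq by (auto simp: joined_iff)
      then have "p < 2 * Suc m" "q < 2 * Suc m" "?\<mu> p = p" "?\<mu> q = q" by auto
      then show ?thesis using pq j1[of p q] j2[of p q] by auto
    qed
    show "(p, \<rho> p) \<in> (joined (Suc m) K1 \<union> joined (Suc m) K2)\<^sup>+" if "p \<in> {..<2 * Suc m}" for p
    proof -
      have "?\<mu> (\<rho> p) = \<rho> p" "\<rho> p < 2 * Suc m" using \<rho>_less[of p] by auto
      then have "(p, \<rho> p) \<in> joined (Suc m) K2"
        using j2[of p "\<rho> p"] that joined_sym[OF \<rho>\<mu>[of p]] by simp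
      then show ?thesis by blast
    qed
  qed (use kl sym_joined_Un in auto)
qed

end

text \<open>The curve made of the new chord and its mirror image separates gap \<open>2m\<close>
  from all others, and no hole of \<open>b\<close> borders that gap. The term
  \<open>hole_region b' b'\<close> expresses the regions of \<open>X2\<close> and \<open>Y2\<close>
  through \<open>b'\<close> alone, so the right-hand side is free of \<open>b\<close>.\<close>

lemma curve_indet_cap:
  assumes "m > 0" and b: "b \<in> diagrams m" and b': "b' \<in> diagrams (Suc m)" and cap: "cap m \<in> chords b'"
  shows "curve_indet (Suc m) (add_cap m b) b' (cap m) =
    (THE v. \<forall>h h'.
      ((h \<in> {X2, Y2} \<and> 2 * m \<in> hole_region b' b' h) = (h' \<in> {X2, Y2} \<and> 2 * m \<in> hole_region b' b' h')) \<longleftrightarrow>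
      (h \<in> one_side v \<longleftrightarrow> h' \<in> one_side v))"
proof -
  interpret capped m "chords b"
    using assms by unfold_locales (auto dest: diagramsD)
  let ?M = "insert (cap m) (chords b)"
  let ?H = "hole_region (add_cap m b) b'"
  let ?P = "\<lambda>h. h \<in> {X2, Y2} \<and> 2 * m \<in> hole_region b' b' h"
  have sub: "c = cap m" if c: "c \<in> chords a" "c \<subseteq> cap m" and a: "a \<in> diagrams n" for a c n
  proof -
    obtain p q where "c = {p, q}" "p < q"
      by (rule noncrossing_matching_chord[OF diagramsD(1)[OF a] c(1)])
    then show ?thesis using c(2) by (auto simp: cap_def)
  qed
  have "{c \<in> chords (add_cap m b). c \<subseteq> cap m} = {cap m}"
    using sub[of _ "add_cap m b" "Suc m"] add_cap_in_diagrams[OF assms(1,2)]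
    by (auto simp: add_cap_def Let_def)
  moreover have "{c \<in> chords b'. c \<subseteq> cap m} = {cap m}"
    using sub[OF _ _ b'] cap by auto
  moreover have "(joined (Suc m) {cap m})\<^sup>+ = joined (Suc m) {cap m}"
    using equiv_joined by (simp add: equiv_def trancl_id)
  ultimately have same: "same_side (Suc m) (add_cap m b) b' (cap m) = joined (Suc m) {cap m}"
    by (simp add: same_side_def)
  have X1Y1: "?H h = joined (Suc m) ?M `` hole_region b b h \<and> hole_region b b h \<in> regions m (chords b)"
    if "h = X1 \<or> h = Y1" for h
    using that diagramsD[OF b] by (auto simp: add_cap_def Let_def)
  have X2Y2: "?H h = hole_region b' b' h \<and> ?H h \<in> regions (Suc m) (chords b')" if "h = X2 \<or> h = Y2" for h
    using that diagramsD[OF b'] by auto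
  have region: "?H h \<in> regions (Suc m) (if h = X1 \<or> h = Y1 then ?M else chords b')" for h
    using X1Y1[of h] X2Y2[of h] capped_region(1)[of "hole_region b b h"] by (cases h) auto
  have P: "2 * m \<in> ?H h \<longleftrightarrow> ?P h" for h
    using X1Y1[of h] X2Y2[of h] capped_region(3)[of "hole_region b b h"] by (cases h) auto
  \<comment> \<open>The cap is a chord of both diagrams, so a region that contains gap
    \<open>2m\<close> has no other gap. The answer is therefore the same for every gap
    \<open>k\<close> of the hole.\<close>
  have side: "k = 2 * m \<longleftrightarrow> ?P h" if k: "k \<in> ?H h" for k h
  proof -
    have "l \<in> ?H h \<Longrightarrow> k = 2 * m \<longleftrightarrow> l = 2 * m" for l
      using joined_in_region[OF region k, of l] cap by (auto simp: joined_iff separates_cap split: if_splits)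
    then show ?thesis using k P by metis
  qed
  have less: "k < 2 * Suc m" if "k \<in> ?H h" for k h
    using region_less[OF region that] .
  have ex: "\<exists>k. k \<in> ?H h" for h using region[of h] by (auto elim!: regionE)
  have "holes_same_side (Suc m) (add_cap m b) b' (cap m) h h' \<longleftrightarrow> ?P h = ?P h'" for h h'
  proof -
    have "(k, l) \<in> joined (Suc m) {cap m} \<longleftrightarrow> ?P h = ?P h'" if "k \<in> ?H h" "l \<in> ?H h'" for k l
      using side[OF that(1)] side[OF that(2)] less[OF that(1)] less[OF that(2)]
      by (simp add: joined_iff separates_cap)
    then show ?thesis
      using ex[of h] ex[of h'] unfolding holes_same_side_def same by blast
  qed
  then show ?thesis by (simp add: curve_indet_def)
qed

section \<open>Pairing with a diagram that has a chord at the cap\<close>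

lemma curve_subset:
  assumes "noncrossing_matching n (chords b)" "noncrossing_matching n (chords b')" "C \<in> curves n b b'"
  shows "C \<subseteq> {..<2 * n}"
  using assms(3) equiv_type[OF equiv_join_points[OF assms(1,2)]]
  by (auto simp: curves_eq quotient_def)

text \<open>A path cannot switch between \<open>S\<close> and \<open>A\<close>. With the cap as
  \<open>S\<close>, the new points form a curve of their own and the old curves are
  unchanged.\<close>

lemma trancl_Un_square:
  assumes "J \<subseteq> A \<times> A" "A \<inter> S = {}"
  shows "(S \<times> S \<union> J)\<^sup>+ = S \<times> S \<union> J\<^sup>+"
proof (intro equalityI subrelI)
  have J: "J\<^sup>+ \<subseteq> A \<times> A" using assms(1) by (rule trancl_subset_Sigma)
  fix p q assume "(p, q) \<in> (S \<times> S \<union> J)\<^sup>+"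
  then show "(p, q) \<in> S \<times> S \<union> J\<^sup>+"
  proof (induction rule: trancl_induct)
    case (base q)
    then show ?case by blast
  next
    case (step q r)
    then consider "p \<in> S" "q \<in> S" "r \<in> S" | "(p, q) \<in> J\<^sup>+" "(q, r) \<in> J"
      using J assms by blast
    then show ?case by cases (auto intro: trancl_into_trancl)
  qed
next
  fix p q assume "(p, q) \<in> S \<times> S \<union> J\<^sup>+"
  then show "(p, q) \<in> (S \<times> S \<union> J)\<^sup>+"
    by (auto intro: trancl_mono)
qed

lemma noncrossing_matching_remove_cap:
  assumes M: "noncrossing_matching (Suc m) M" and cap: "cap m \<in> M"
  shows "noncrossing_matching m (M - {cap m})"
proof -
  have pair: "\<exists>a b. c = {a, b} \<and> a < b \<and> b < 2 * m" if c: "c \<in> M - {cap m}" for c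
  proof -
    have "c \<in> M" using c by simp
    then obtain a b where ab: "c = {a, b}" "a < b" "b < 2 * Suc m"
      by (rule noncrossing_matching_chord[OF M])
    have "b \<notin> cap m"
      using noncrossing_matching_unique[OF M \<open>c \<in> M\<close> cap, of b] c ab(1) by auto
    then have "b < 2 * m" using ab(3) by (auto simp: cap_def)
    then show ?thesis using ab by blast
  qed
  have cover: "\<exists>c\<in>M - {cap m}. p \<in> c" if p: "p < 2 * m" for p
  proof -
    obtain q where "{p, q} \<in> M" by (rule noncrossing_matching_ex_chord[OF M, of p]) (use p in auto)
    moreover have "p \<notin> cap m" using p by (simp add: cap_def)
    ultimately show ?thesis by (intro bexI[of _ "{p, q}"]) auto
  qed
  show ?thesis
    unfolding noncrossing_matching_iff
  proof (intro conjI)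
    show "\<forall>c\<in>M - {cap m}. \<forall>c'\<in>M - {cap m}. \<forall>p. p \<in> c \<longrightarrow> p \<in> c' \<longrightarrow> c = c'"
      using noncrossing_matching_unique[OF M] by (meson DiffD1)
    show "\<forall>i j k l. {i, k} \<in> M - {cap m} \<longrightarrow> {j, l} \<in> M - {cap m} \<longrightarrow> i < j \<longrightarrow> j < k \<longrightarrow> \<not> k < l"
      using noncrossing_matching_no_crossing[OF M] by (meson DiffD1)
  qed (use pair cover in auto)
qed

lemma pairing_cap:
  assumes m: "m > 0" and b': "b' \<in> diagrams (Suc m)" and cap: "cap m \<in> chords b'"
  shows "\<exists>b''\<in>diagrams m. \<exists>f. \<forall>b\<in>diagrams m. pairing (Suc m) (add_cap m b) b' = f * pairing m b b''"
proof -
  define N where "N = chords b' - {cap m}"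
  have N: "noncrossing_matching m N"
    unfolding N_def using diagramsD(1)[OF b'] cap by (rule noncrossing_matching_remove_cap)
  have chords_b': "chords b' = insert (cap m) N" using cap by (auto simp: N_def)
  interpret N: capped m N using m N by unfold_locales
  \<comment> \<open>With the chord at the cap deleted, gap \<open>2m\<close> opens into the region
    of gap \<open>2m - 1\<close>, and the holes it contained go there.\<close>
  define w where "w = 2 * m - 1"
  have \<rho>: "gap_retract m w = (\<lambda>k. min k (2 * m - 1))"
    by (auto simp: gap_retract_def w_def)
  interpret reduction m w b' N
  proof
    show "(gap_retract m w k, gap_retract m w l) \<in> joined m N"
      if kl: "(k, l) \<in> joined (Suc m) (chords b')" for k l
    proof -
      have "(k, l) \<in> joined (Suc m) N" "k < 2 * Suc m" "l < 2 * Suc m"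
        using kl by (auto simp: chords_b' joined_insert joined_iff)
      then show ?thesis unfolding \<rho> using joined_min[OF m N.chord_pair] by blast
    qed
  qed (use m b' N in \<open>auto simp: w_def\<close>)
  \<comment> \<open>The variable of the curve at the cap, fixed before \<open>b\<close> is
    chosen.\<close>
  define f where "f = var (THE v. \<forall>h h'.
      ((h \<in> {X2, Y2} \<and> 2 * m \<in> hole_region b' b' h) = (h' \<in> {X2, Y2} \<and> 2 * m \<in> hole_region b' b' h')) \<longleftrightarrow>
      (h \<in> one_side v \<longleftrightarrow> h' \<in> one_side v))"
  have "pairing (Suc m) (add_cap m b) b' = f * pairing m b reduced" if b: "b \<in> diagrams m" for b
  proof -
    have M: "noncrossing_matching m (chords b)" using diagramsD(1)[OF b] .
    let ?J = "join_points (chords b \<union> N)"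
    have equiv: "equiv {..<2 * m} (?J\<^sup>+)" using equiv_join_points[OF M N] .
    have J: "?J \<subseteq> {..<2 * m} \<times> {..<2 * m}"
      using equiv_type[OF equiv] by (meson order_trans r_into_trancl subrelI)
    have "chords (add_cap m b) \<union> chords b' = insert (cap m) (chords b \<union> N)"
      by (auto simp: chords_add_cap chords_b')
    moreover have disj: "{..<2 * m} \<inter> cap m = {}" by (auto simp: cap_def)
    ultimately have "(join_points (chords (add_cap m b) \<union> chords b'))\<^sup>+ = cap m \<times> cap m \<union> ?J\<^sup>+" (is "?R = _")
      by (simp add: join_points_insert trancl_Un_square[OF J])
    then have R: "?R `` {p} = (if p \<in> cap m then cap m else ?J\<^sup>+ `` {p})" for p
      using disj equiv_type[OF equiv] by auto
    have "curves (Suc m) (add_cap m b) b' = (\<lambda>p. ?R `` {p}) ` ({..<2 * m} \<union> cap m)"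
    proof -
      have "{..<2 * Suc m} = {..<2 * m} \<union> cap m" by (auto simp: cap_def)
      then show ?thesis by (auto simp: curves_eq quotient_def)
    qed
    also have "\<dots> = (\<lambda>p. ?J\<^sup>+ `` {p}) ` {..<2 * m} \<union> (\<lambda>p. cap m) ` cap m"
      unfolding image_Un using disj by (intro arg_cong2[where f = "(\<union>)"] image_cong) (auto simp: R)
    also have "\<dots> = insert (cap m) (curves m b reduced)"
      by (auto simp: curves_eq quotient_def reduced_def cap_def)
    finally have curves: "curves (Suc m) (add_cap m b) b' = insert (cap m) (curves m b reduced)" .
    have sub: "C \<subseteq> {..<2 * m}" if "C \<in> curves m b reduced" for C
      using curve_subset[OF M _ that] N by (simp add: reduced_def)
    then have "cap m \<notin> curves m b reduced" by (auto simp: cap_def)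
    moreover have "finite (curves m b reduced)"
      unfolding curves_eq by (rule finite_quotient) (use equiv_type[OF equiv] in \<open>auto simp: reduced_def\<close>)
    moreover have "curve_indet (Suc m) (add_cap m b) b' C = curve_indet m b reduced C"
      if "C \<in> curves m b reduced" for C
    proof (rule curve_indet_reduced_same_curve[OF b sub[OF that]])
      show "{c \<in> chords b'. c \<subseteq> C} = {c \<in> N. c \<subseteq> C}"
        using sub[OF that] by (auto simp: chords_b' cap_def)
      show "(w, 2 * m - 1) \<in> joined m {c \<in> N. c \<subseteq> C}"
        using m by (simp add: w_def joined_refl)
    qed
    moreover have "var (curve_indet (Suc m) (add_cap m b) b' (cap m)) = f"
      unfolding f_def curve_indet_cap[OF m b b' cap] ..
    ultimately show ?thesis by (simp add: pairing_def curves)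
  qed
  then show ?thesis using reduced_in_diagrams by blast
qed

section \<open>Bending two chords into one\<close>

lemma joined_pair_iff:
  assumes "a < b"
  shows "(k, l) \<in> joined n (insert {a, b} K) \<longleftrightarrow>
    (k, l) \<in> joined n K \<and> ((a \<le> k \<and> k < b) = (a \<le> l \<and> l < b))"
  using assms by (simp add: joined_insert separates_pair)

text \<open>The order \<open>v < u\<close> is the one without a crossing. The strip between the two
  chords lies between gaps \<open>v\<close> to \<open>u - 1\<close> at one end and gap
  \<open>2m\<close> at the other. After bending, it is the side of \<open>{v, u}\<close> that
  contains gap \<open>v\<close>, hence the choice of \<open>v\<close> as retract of gap
  \<open>2m\<close>.\<close>

locale uncapped =
  fixes m u v :: nat and b' :: diagram
  assumes m_pos: "m > 0" and b': "b' \<in> diagrams (Suc m)"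
    and u_chord: "{u, 2 * m} \<in> chords b'" and v_chord: "{v, 2 * m + 1} \<in> chords b'"
    and vu: "v < u" and u_less: "u < 2 * m"
begin

lemma v_less: "v < 2 * m"
  using vu u_less by simp

definition K where "K = chords b' - {{u, 2 * m}, {v, 2 * m + 1}}"

definition N where "N = insert {v, u} K"

lemma matching: "noncrossing_matching (Suc m) (chords b')"
  using diagramsD(1)[OF b'] .

lemma chords_b': "chords b' = insert {u, 2 * m} (insert {v, 2 * m + 1} K)"
  using u_chord v_chord by (auto simp: K_def)

lemma K_disjoint:
  assumes "c \<in> K"
  shows "u \<notin> c" "v \<notin> c" "2 * m \<notin> c" "2 * m + 1 \<notin> c"
proof -
  have c: "c \<in> chords b'" "c \<noteq> {u, 2 * m}" "c \<noteq> {v, 2 * m + 1}"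
    using assms by (auto simp: K_def)
  show "u \<notin> c" "v \<notin> c" "2 * m \<notin> c" "2 * m + 1 \<notin> c"
    using c noncrossing_matching_unique[OF matching c(1) u_chord]
      noncrossing_matching_unique[OF matching c(1) v_chord] by blast+
qed

text \<open>A remaining chord that straddled \<open>v\<close> or \<open>u\<close> would cross the
  chord from there to \<open>2m + 1\<close> or \<open>2m\<close>. This keeps \<open>{v, u}\<close>
  free of crossings and puts gap \<open>v\<close> outside the interval of every remaining chord,
  like gap \<open>2m\<close>.\<close>

lemma K_chord:
  assumes c: "c \<in> K"
  obtains s t where "c = {s, t}" "s < t" "t < 2 * m" "v < s \<or> t < v" "u < s \<or> t < u"
proof -
  have cb: "c \<in> chords b'" using c by (simp add: K_def)
  then obtain s t where st: "c = {s, t}" "s < t" "t < 2 * Suc m"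
    by (rule noncrossing_matching_chord[OF matching])
  have "s \<noteq> v" "t \<noteq> v" "s \<noteq> u" "t \<noteq> u" "t < 2 * m"
    using K_disjoint[OF c] st by (auto simp: less_Suc_eq)
  moreover have "\<not> (s < v \<and> v < t)"
    using noncrossing_matching_no_crossing[OF matching, of s t v "2 * m + 1"] v_chord cb st(1) \<open>t < 2 * m\<close> by auto
  moreover have "\<not> (s < u \<and> u < t)"
    using noncrossing_matching_no_crossing[OF matching, of s t u "2 * m"] u_chord cb st(1) \<open>t < 2 * m\<close> by auto
  ultimately show thesis using that st by (metis linorder_neqE_nat)
qed

lemma K_subset: "c \<in> K \<Longrightarrow> c \<subseteq> {..<2 * m}"
  by (erule K_chord) auto

lemma N_matching: "noncrossing_matching m N"
  unfolding noncrossing_matching_iff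
proof (intro conjI)
  show "\<forall>c\<in>N. \<exists>a b. c = {a, b} \<and> a < b \<and> b < 2 * m"
  proof
    fix c assume "c \<in> N"
    then consider "c = {v, u}" | "c \<in> K" by (auto simp: N_def)
    then show "\<exists>a b. c = {a, b} \<and> a < b \<and> b < 2 * m"
    proof cases
      case 1
      then show ?thesis using vu u_less by blast
    next
      case 2
      then show ?thesis by (rule K_chord) blast
    qed
  qed
  show "\<forall>p<2 * m. \<exists>c\<in>N. p \<in> c"
  proof (intro allI impI)
    fix p assume p: "p < 2 * m"
    then have "p < 2 * Suc m" by simp
    then obtain q where q: "{p, q} \<in> chords b'" by (rule noncrossing_matching_ex_chord[OF matching])
    show "\<exists>c\<in>N. p \<in> c"
    proof (cases "p = u \<or> p = v")
      case False
      then have "{p, q} \<in> K" using q p by (auto simp: K_def doubleton_eq_iff)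
      then show ?thesis by (intro bexI[of _ "{p, q}"]) (auto simp: N_def)
    qed (auto simp: N_def)
  qed
  show "\<forall>c\<in>N. \<forall>c'\<in>N. \<forall>p. p \<in> c \<longrightarrow> p \<in> c' \<longrightarrow> c = c'"
  proof (intro ballI allI impI)
    fix c c' p assume "c \<in> N" "c' \<in> N" and p: "p \<in> c" "p \<in> c'"
    then consider "c = {v, u}" "c' = {v, u}" | "c = {v, u}" "c' \<in> K" | "c \<in> K" "c' = {v, u}" | "c \<in> K" "c' \<in> K"
      by (auto simp: N_def)
    then show "c = c'"
    proof cases
      case 4
      then have "c \<in> chords b'" "c' \<in> chords b'" by (auto simp: K_def)
      then show ?thesis using noncrossing_matching_unique[OF matching] p by blast
    qed (use p K_disjoint in auto)
  qed
  show "\<forall>i j k l. {i, k} \<in> N \<longrightarrow> {j, l} \<in> N \<longrightarrow> i < j \<longrightarrow> j < k \<longrightarrow> \<not> k < l"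
  proof (intro allI impI)
    fix i j k l assume ik: "{i, k} \<in> N" and jl: "{j, l} \<in> N" and ij: "i < j" and jk: "j < k"
    have vu_eq: "a = v \<and> b = u" if "{a, b} = {v, u}" "a < b" for a b
      using that vu by (auto simp: doubleton_eq_iff)
    show "\<not> k < l"
    proof
      assume kl: "k < l"
      have K: "(v < a \<or> b < v) \<and> (u < a \<or> b < u)" if "{a, b} \<in> K" "a < b" for a b
        using that(1)
      proof (rule K_chord)
        fix s t assume "{a, b} = {s, t}" "s < t" "v < s \<or> t < v" "u < s \<or> t < u"
        then show ?thesis using that(2) by (auto simp: doubleton_eq_iff)
      qed
      consider "{i, k} = {v, u}" "{j, l} = {v, u}" | "{i, k} = {v, u}" "{j, l} \<in> K"
        | "{i, k} \<in> K" "{j, l} = {v, u}" | "{i, k} \<in> K" "{j, l} \<in> K"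
        using ik jl by (auto simp: N_def)
      then show False
      proof cases
        case 1
        then show ?thesis using vu_eq[of i k] vu_eq[of j l] ij jk kl by simp
      next
        case 2
        then show ?thesis using vu_eq[of i k] K[of j l] ij jk kl by auto
      next
        case 3
        then show ?thesis using vu_eq[of j l] K[of i k] ij jk kl by auto
      next
        case 4
        then show ?thesis using noncrossing_matching_no_crossing[OF matching, of i k j l] ij jk kl
          by (auto simp: K_def)
      qed
    qed
  qed
qed

lemma joined_K_retract:
  assumes "L \<subseteq> K" "k < 2 * Suc m" "l < 2 * Suc m"
  shows "(k, l) \<in> joined (Suc m) L \<longleftrightarrow> (gap_retract m v k, gap_retract m v l) \<in> joined m L"
proof -
  have "separates c k l \<longleftrightarrow> separates c (gap_retract m v k) (gap_retract m v l)" if "c \<in> L" for c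
  proof -
    have "c \<in> K" using that assms(1) by blast
    then obtain s t where st: "c = {s, t}" "s < t" "t < 2 * m" "v < s \<or> t < v"
      by (rule K_chord)
    then have "s \<le> gap_retract m v p \<and> gap_retract m v p < t \<longleftrightarrow> s \<le> p \<and> p < t" for p
      by (auto simp: gap_retract_def)
    then show ?thesis using st(1,2) by (simp only: separates_pair)
  qed
  moreover have "gap_retract m v p < 2 * m" for p
    using v_less by (auto simp: gap_retract_def)
  ultimately show ?thesis using assms(2,3) by (auto simp: joined_iff)
qed

text \<open>The strip is where exactly one of the intervals of the two chords contains the gap; the
  interval from \<open>u\<close> to \<open>2m\<close> lies inside the other one.\<close>

lemma strip_retract:
  assumes "k < 2 * Suc m"
  shows "(v \<le> gap_retract m v k \<and> gap_retract m v k < u) \<longleftrightarrow> (u \<le> k \<and> k < 2 * m) \<noteq> (v \<le> k \<and> k < 2 * m + 1)"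
  using assms vu u_less by (auto simp: gap_retract_def)

text \<open>If neither chord separates two gaps, both gaps are in the strip or both are outside it.
  The converse can fail, since the outside of the strip has two components; they are reconnected
  only by the cap.\<close>

lemma joined_bend:
  assumes L: "L \<subseteq> K" and kl: "(k, l) \<in> joined (Suc m) (insert {u, 2 * m} (insert {v, 2 * m + 1} L))"
  shows "(gap_retract m v k, gap_retract m v l) \<in> joined m (insert {v, u} L)"
proof -
  have less: "k < 2 * Suc m" "l < 2 * Suc m" using kl by (auto simp: joined_iff)
  have "v < 2 * m + 1" using v_less by simp
  then have "(k, l) \<in> joined (Suc m) L" "(u \<le> k \<and> k < 2 * m) = (u \<le> l \<and> l < 2 * m)"
    "(v \<le> k \<and> k < 2 * m + 1) = (v \<le> l \<and> l < 2 * m + 1)"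
    using kl joined_pair_iff[OF u_less] joined_pair_iff[of v "2 * m + 1"] by auto
  then show ?thesis
    using joined_K_retract[OF L less] strip_retract[OF less(1)] strip_retract[OF less(2)]
    unfolding joined_pair_iff[OF vu] by blast
qed

text \<open>The gaps on the outer side of the bent chord \<open>{v, u}\<close> may lie on different sides of the strip
  between the two chords of \<open>b'\<close>; these are linked through the gaps \<open>2m - 1\<close> and \<open>2m + 1\<close> around the cap.\<close>

lemma joined_unbend:
  assumes L: "L \<subseteq> K" and P: "(2 * m - 1, 2 * m + 1) \<in> P" "sym P"
    and kl: "(k, l) \<in> joined m (insert {v, u} L)"
  shows "(k, l) \<in> (P \<union> joined (Suc m) (insert {u, 2 * m} (insert {v, 2 * m + 1} L)))\<^sup>+"
proof -
  let ?J = "joined (Suc m) (insert {u, 2 * m} (insert {v, 2 * m + 1} L))"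
  have v': "v < 2 * m + 1" using v_less by simp
  have J_iff: "(p, q) \<in> ?J \<longleftrightarrow> (p, q) \<in> joined (Suc m) L \<and> ((u \<le> p \<and> p < 2 * m) = (u \<le> q \<and> q < 2 * m)) \<and>
      ((v \<le> p \<and> p < 2 * m + 1) = (v \<le> q \<and> q < 2 * m + 1))" for p q
    unfolding joined_pair_iff[OF u_less] joined_pair_iff[OF v'] by blast
  have across: "(p, q) \<in> (P \<union> ?J)\<^sup>+"
    if pq: "(p, q) \<in> joined m L" and p: "u \<le> p" "p < 2 * m" and q: "q < v" for p q
  proof -
    \<comment> \<open>A chord that does not separate \<open>p\<close> and \<open>q\<close> has both
      or neither in its interval. Both would make it straddle \<open>v\<close>, so \<open>p\<close>
      and \<open>q\<close> lie outside, together with gaps \<open>2m - 1\<close> and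
      \<open>2m + 1\<close>.\<close>
    have out: "\<not> separates c p (2 * m - 1) \<and> \<not> separates c q (2 * m + 1)" if "c \<in> L" for c
    proof -
      have "c \<in> K" using that L by blast
      then obtain s t where st: "c = {s, t}" "s < t" "t < 2 * m" "v < s \<or> t < v"
        by (rule K_chord)
      have "(s \<le> p \<and> p < t) = (s \<le> q \<and> q < t)"
        using pq that st(1,2) by (auto simp: joined_iff separates_pair)
      then show ?thesis using st(2-) p q vu unfolding st(1) separates_pair[OF st(2)] by linarith
    qed
    then have "(p, 2 * m - 1) \<in> joined (Suc m) L" "(q, 2 * m + 1) \<in> joined (Suc m) L"
      using p q vu u_less by (auto simp: joined_iff)
    then have "(p, 2 * m - 1) \<in> ?J" "(q, 2 * m + 1) \<in> ?J"
      unfolding J_iff using p q vu u_less by auto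
    then have "(p, 2 * m - 1) \<in> ?J" "(2 * m + 1, q) \<in> ?J"
      by (auto intro: joined_sym)
    then show ?thesis using P(1) by (meson UnCI r_into_trancl trancl_trans)
  qed
  have sym: "sym (P \<union> ?J)" using P(2) by (auto simp: sym_def dest: joined_sym)
  have less: "k < 2 * m" "l < 2 * m" using kl by (auto simp: joined_iff)
  have "(k, l) \<in> joined m L" and strip: "(v \<le> k \<and> k < u) = (v \<le> l \<and> l < u)"
    using kl unfolding joined_pair_iff[OF vu] by blast+
  then have kl_L: "(k, l) \<in> joined m L" "(l, k) \<in> joined m L" by (auto intro: joined_sym)
  have "gap_retract m v k = k" "gap_retract m v l = l" using less by (auto simp: gap_retract_def)
  then have kl': "(k, l) \<in> joined (Suc m) L"
    using joined_K_retract[OF L, of k l] kl_L less by simp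
  consider "(u \<le> k) = (u \<le> l)" | "u \<le> k" "l < u" | "u \<le> l" "k < u" by linarith
  then show ?thesis
  proof cases
    case 1
    moreover from this have "(v \<le> k) = (v \<le> l)" using strip vu by auto
    ultimately have "(k, l) \<in> ?J" unfolding J_iff using kl' less by auto
    then show ?thesis by blast
  next
    case 2
    then have "l < v" using strip by auto
    then show ?thesis using across[OF kl_L(1)] 2 less by simp
  next
    case 3
    then have "k < v" using strip by auto
    then have "(l, k) \<in> (P \<union> ?J)\<^sup>+" using across[OF kl_L(2)] 3 less by simp
    then show ?thesis using sym_trancl[OF sym] by (rule symD[rotated])
  qed
qed

end

sublocale uncapped \<subseteq> reduction m v b' N
proof
  show "(gap_retract m v k, gap_retract m v l) \<in> joined m N" if "(k, l) \<in> joined (Suc m) (chords b')" for k l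
    using joined_bend[of K k l] that by (simp add: chords_b' N_def)
qed (use m_pos b' N_matching v_less in auto)

context uncapped
begin

text \<open>Unlike gaps, points are retracted along the chords of \<open>b'\<close>, so
  \<open>p\<close> and \<open>\<sigma> p\<close> always lie on the same curve.\<close>

definition \<sigma> :: "nat \<Rightarrow> nat" where
  "\<sigma> p = (if p = 2 * m then u else if p = 2 * m + 1 then v else p)"

lemma \<sigma>_less: "p < 2 * Suc m \<Longrightarrow> \<sigma> p < 2 * m"
  using u_less v_less by (auto simp: \<sigma>_def)

lemma \<sigma>_id: "p < 2 * m \<Longrightarrow> \<sigma> p = p"
  by (simp add: \<sigma>_def)

lemma chords_reduced: "chords reduced = N"
  by (simp add: reduced_def)

text \<open>The path from \<open>u\<close> over \<open>2m\<close> and \<open>2m + 1\<close> to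
  \<open>v\<close> consists of two chords of \<open>b'\<close> and the cap; \<sigma> contracts it to
  the bent chord.\<close>

lemma join_points_retract:
  assumes b: "b \<in> diagrams m" and pq: "p < 2 * Suc m" "q < 2 * Suc m"
  shows "(p, q) \<in> (join_points (chords (add_cap m b) \<union> chords b'))\<^sup>+ \<longleftrightarrow>
    (\<sigma> p, \<sigma> q) \<in> (join_points (chords b \<union> N))\<^sup>+" (is "_ \<in> ?R\<^sup>+ \<longleftrightarrow> _ \<in> ?Q\<^sup>+")
proof (rule trancl_iff_retract[where A = "{..<2 * Suc m}"])
  interpret b: capped m "chords b"
    using m_pos b by unfold_locales (auto dest: diagramsD)
  have less: "c \<subseteq> {..<2 * m}" if "c \<in> chords b \<union> K" for c
    using that b.chord_pair[of c] K_subset[of c] by auto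
  have equiv: "equiv {..<2 * Suc m} (?R\<^sup>+)"
    using noncrossing_matching_add_cap[OF diagramsD(1)[OF b]] matching
    by (intro equiv_join_points) (simp_all add: chords_add_cap)
  have R: "(p, q) \<in> ?R" if "c \<in> insert (cap m) (chords b) \<union> chords b'" "p \<in> c" "q \<in> c" for c p q
    using that by (auto simp: join_points_def chords_add_cap)
  have Q: "(p, q) \<in> ?Q" if "c \<in> chords b \<union> N" "p \<in> c" "q \<in> c" for c p q
    using that by (auto simp: join_points_def)
  show "(\<sigma> p, \<sigma> q) \<in> ?Q\<^sup>+" if step: "(p, q) \<in> ?R" for p q
  proof -
    obtain c where c: "c \<in> insert (cap m) (chords b) \<union> chords b'" "p \<in> c" "q \<in> c"
      using step by (auto simp: join_points_def chords_add_cap)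
    then consider "c \<in> chords b \<union> K" | "c = cap m \<or> c = {u, 2 * m} \<or> c = {v, 2 * m + 1}"
      by (auto simp: chords_b')
    then have "(\<sigma> p, \<sigma> q) \<in> ?Q"
    proof cases
      case 1
      then have "p < 2 * m" "q < 2 * m" using less c by blast+
      then show ?thesis using Q[of c p q] 1 c by (auto simp: \<sigma>_id N_def)
    next
      case 2
      then have "\<sigma> p \<in> {v, u}" "\<sigma> q \<in> {v, u}"
        using c(2,3) \<sigma>_id[OF u_less] \<sigma>_id[OF v_less] by (auto simp: cap_def \<sigma>_def)
      then show ?thesis by (intro Q[of "{v, u}"]) (auto simp: N_def)
    qed
    then show ?thesis by blast
  qed
  have up: "(u, 2 * m) \<in> ?R" "(2 * m, u) \<in> ?R" "(2 * m + 1, v) \<in> ?R" "(v, 2 * m + 1) \<in> ?R"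
    using R[of "{u, 2 * m}"] R[of "{v, 2 * m + 1}"] u_chord v_chord by auto
  have cap: "(2 * m, 2 * m + 1) \<in> ?R" "(2 * m + 1, 2 * m) \<in> ?R"
    using R[of "cap m"] by (auto simp: cap_def)
  have refl: "(p, p) \<in> ?R\<^sup>+" if "p < 2 * Suc m" for p
    using equiv_class_self[OF equiv, of p] that by simp
  have uv: "(u, v) \<in> ?R\<^sup>+" "(v, u) \<in> ?R\<^sup>+"
    using up cap by (meson r_into_trancl trancl_into_trancl)+
  show "(p, q) \<in> ?R\<^sup>+" if step: "(p, q) \<in> ?Q" for p q
  proof -
    obtain c where c: "c \<in> chords b \<union> N" "p \<in> c" "q \<in> c"
      using step by (auto simp: join_points_def)
    then consider "c \<in> chords b \<union> chords b'" | "c = {v, u}"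
      by (auto simp: N_def chords_b')
    then show ?thesis
    proof cases
      case 1
      then show ?thesis using R[of c p q] c by auto
    next
      case 2
      then show ?thesis using c uv refl[of u] refl[of v] u_less v_less by auto
    qed
  qed
  show "(p, \<sigma> p) \<in> ?R\<^sup>+" if "p \<in> {..<2 * Suc m}" for p
    using that refl[of p] up by (auto simp: \<sigma>_def)
qed (use pq sym_join_points in auto)

text \<open>For the curve through the cap. Gap \<open>2m\<close> is linked to its retract
  \<open>v\<close> through the strip, on the side of \<open>b'\<close>; gap \<open>2m + 1\<close> is
  linked to \<open>2m - 1\<close> around the cap, on the side of \<open>b\<close>.\<close>

lemma curve_indet_bent:
  assumes b: "b \<in> diagrams m" and C: "C \<subseteq> {..<2 * m}" and uv: "u \<in> C" "v \<in> C"
  shows "curve_indet (Suc m) (add_cap m b) b' (C \<union> {2 * m, 2 * m + 1}) = curve_indet m b reduced C"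
proof (rule curve_indet_reduced[OF b])
  fix k l assume kl: "k < 2 * Suc m" "l < 2 * Suc m"
  let ?C = "C \<union> {2 * m, 2 * m + 1}"
  interpret b: capped m "chords b"
    using m_pos b by unfold_locales (auto dest: diagramsD)
  define K1 where "K1 = {c \<in> chords b. c \<subseteq> C}"
  define K2 where "K2 = {c \<in> K. c \<subseteq> C}"
  have K2: "K2 \<subseteq> K" by (auto simp: K2_def)
  let ?J1 = "joined (Suc m) (insert (cap m) K1)"
  let ?J2 = "joined (Suc m) (insert {u, 2 * m} (insert {v, 2 * m + 1} K2))"
  let ?Q2 = "joined m (insert {v, u} K2)"
  have sub_C: "c \<subseteq> ?C \<longleftrightarrow> c \<subseteq> C" if "c \<subseteq> {..<2 * m}" for c
  proof -
    have "2 * m \<notin> c" "2 * m + 1 \<notin> c" using that by auto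
    then show ?thesis by blast
  qed
  have "{c \<in> chords (add_cap m b). c \<subseteq> ?C} = insert (cap m) K1"
  proof -
    have "c \<subseteq> ?C \<longleftrightarrow> c \<subseteq> C" if "c \<in> chords b" for c
      using b.chord_pair[OF that] by (intro sub_C) auto
    then show ?thesis by (auto simp: chords_add_cap K1_def cap_def)
  qed
  moreover have "{c \<in> chords b'. c \<subseteq> ?C} = insert {u, 2 * m} (insert {v, 2 * m + 1} K2)"
  proof -
    have "c \<subseteq> ?C \<longleftrightarrow> c \<subseteq> C" if "c \<in> K" for c
      using K_subset[OF that] by (rule sub_C)
    then show ?thesis using uv by (auto simp: chords_b' K2_def)
  qed
  ultimately have same: "same_side (Suc m) (add_cap m b) b' ?C = (?J1 \<union> ?J2)\<^sup>+"
    by (simp add: same_side_def)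
  have "{c \<in> N. c \<subseteq> C} = insert {v, u} K2"
    using uv by (auto simp: N_def K2_def)
  then have same': "same_side m b reduced C = (joined m K1 \<union> ?Q2)\<^sup>+"
    by (simp add: same_side_def chords_reduced K1_def)
  have K1_pair: "\<exists>s t. c = {s, t} \<and> s < t \<and> t < 2 * m" if "c \<in> K1" for c
    using that b.chord_pair by (auto simp: K1_def)
  have J1: "(p, q) \<in> ?J1 \<longleftrightarrow> (min p (2 * m - 1), min q (2 * m - 1)) \<in> joined m K1 \<and> (p = 2 * m \<longleftrightarrow> q = 2 * m)"
    if "p < 2 * Suc m" "q < 2 * Suc m" for p q
    using joined_min[OF m_pos K1_pair that] by (auto simp: joined_insert separates_cap)
  have ends: "(2 * m - 1, 2 * m + 1) \<in> ?J1"
    using m_pos J1[of "2 * m - 1" "2 * m + 1"] by (simp add: joined_refl)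
  show "(k, l) \<in> same_side (Suc m) (add_cap m b) b' ?C \<longleftrightarrow> (\<rho> k, \<rho> l) \<in> same_side m b reduced C"
    unfolding same same'
  proof (rule trancl_iff_retract[where A = "{..<2 * Suc m}"])
    show "(\<rho> p, \<rho> q) \<in> (joined m K1 \<union> ?Q2)\<^sup>+" if "(p, q) \<in> ?J1 \<union> ?J2" for p q
      using that
    proof
      assume pq: "(p, q) \<in> ?J1"
      then have less: "p < 2 * Suc m" "q < 2 * Suc m" by (auto simp: joined_iff)
      have "(\<rho> p, \<rho> q) \<in> joined m K1"
      proof (cases "p = 2 * m")
        case True
        then have "q = 2 * m" using pq J1[OF less] by simp
        then show ?thesis using True joined_refl[OF \<rho>_less] by simp
      next
        case False
        then show ?thesis using pq J1[OF less] by (simp add: gap_retract_def)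
      qed
      then show ?thesis by blast
    next
      assume "(p, q) \<in> ?J2"
      then show ?thesis using joined_bend[OF K2] by blast
    qed
    show "(p, q) \<in> (?J1 \<union> ?J2)\<^sup>+" if "(p, q) \<in> joined m K1 \<union> ?Q2" for p q
      using that
    proof
      assume pq: "(p, q) \<in> joined m K1"
      then have "p < 2 * m" "q < 2 * m" by (auto simp: joined_iff)
      moreover from this have "min p (2 * m - 1) = p" "min q (2 * m - 1) = q" by auto
      ultimately have "(p, q) \<in> ?J1" using J1[of p q] pq by simp
      then show ?thesis by blast
    next
      assume "(p, q) \<in> ?Q2"
      moreover have "sym ?J1" by (auto intro: symI joined_sym)
      ultimately show ?thesis using joined_unbend[OF K2 ends] by blast
    qed
    show "(p, \<rho> p) \<in> (?J1 \<union> ?J2)\<^sup>+" if p: "p \<in> {..<2 * Suc m}" for p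
    proof -
      consider "p < 2 * m" | "p = 2 * m" | "p = 2 * m + 1" using p by fastforce
      then show ?thesis
      proof cases
        case 1
        then have "(p, \<rho> p) \<in> ?J1" using p by (simp add: \<rho>_id joined_refl)
        then show ?thesis by blast
      next
        case 2
        have "\<rho> (2 * m) = v" "\<rho> v = v" using v_less by (auto simp: gap_retract_def)
        then have "(2 * m, v) \<in> joined (Suc m) K2"
          using joined_K_retract[OF K2, of "2 * m" v] v_less by (simp add: joined_refl)
        moreover have "v < 2 * m + 1" using v_less by simp
        ultimately have "(2 * m, v) \<in> ?J2"
          unfolding joined_pair_iff[OF u_less] joined_pair_iff[OF \<open>v < 2 * m + 1\<close>] using vu by simp
        then show ?thesis using 2 \<open>\<rho> (2 * m) = v\<close> by auto
      next
        case 3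
        then have "\<rho> p = 2 * m - 1" by (simp add: gap_retract_def)
        then have "(p, \<rho> p) \<in> ?J1" using 3 joined_sym[OF ends] by simp
        then show ?thesis by blast
      qed
    qed
  qed (use kl sym_joined_Un in auto)
qed

lemma pairing_uncapped:
  assumes b: "b \<in> diagrams m"
  shows "pairing (Suc m) (add_cap m b) b' = pairing m b reduced"
proof -
  let ?R = "(join_points (chords (add_cap m b) \<union> chords b'))\<^sup>+"
  let ?Q = "(join_points (chords b \<union> N))\<^sup>+"
  let ?pre = "\<lambda>C. {p \<in> {..<2 * Suc m}. \<sigma> p \<in> C}"
  have M: "noncrossing_matching m (chords b)" using diagramsD(1)[OF b] .
  have Q: "equiv {..<2 * m} ?Q" using equiv_join_points[OF M N_matching] .
  have "equiv {..<2 * Suc m} ?R"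
    using noncrossing_matching_add_cap[OF M] matching
    by (intro equiv_join_points) (simp_all add: chords_add_cap)
  then have "bij_betw ?pre ({..<2 * m} // ?Q) ({..<2 * Suc m} // ?R)"
    using Q
  proof (rule quotient_retract)
    show "\<sigma> ` {..<2 * Suc m} \<subseteq> {..<2 * m}" using \<sigma>_less by auto
    show "\<sigma> p = p" if "p \<in> {..<2 * m}" for p using that \<sigma>_id by simp
    show "(p, q) \<in> ?R \<longleftrightarrow> (\<sigma> p, \<sigma> q) \<in> ?Q" if "p \<in> {..<2 * Suc m}" "q \<in> {..<2 * Suc m}" for p q
      using that join_points_retract[OF b] by simp
  qed auto
  then have bij: "bij_betw ?pre (curves m b reduced) (curves (Suc m) (add_cap m b) b')"
    by (simp add: curves_eq chords_reduced)
  have "curve_indet (Suc m) (add_cap m b) b' (?pre C) = curve_indet m b reduced C"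
    if C: "C \<in> curves m b reduced" for C
  proof -
    have sub: "C \<subseteq> {..<2 * m}"
      using curve_subset[OF M _ C] N_matching by (simp add: chords_reduced)
    have "(u, v) \<in> ?Q" by (auto simp: join_points_def N_def)
    then have uv: "u \<in> C \<longleftrightarrow> v \<in> C"
      using C Q unfolding curves_eq chords_reduced by (meson in_quotient_imp_closed equivE symD)
    show ?thesis
    \<comment> \<open>The curve through \<open>u\<close> and \<open>v\<close> gains the two new
      points; all other curves keep their points.\<close>
    proof (cases "u \<in> C")
      case True
      then have "?pre C = C \<union> {2 * m, 2 * m + 1}"
        using uv sub by (auto simp: \<sigma>_def)
      then show ?thesis using curve_indet_bent[OF b sub] True uv by simp
    next
      case False
      then have "?pre C = C"
        using uv sub by (auto simp: \<sigma>_def)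
      moreover have "{c \<in> N. c \<subseteq> C} = {c \<in> K. c \<subseteq> C}" "{c \<in> chords b'. c \<subseteq> C} = {c \<in> K. c \<subseteq> C}"
        using False uv by (auto simp: N_def chords_b')
      moreover have "(v, 2 * m - 1) \<in> joined m {c \<in> K. c \<subseteq> C}"
      proof -
        \<comment> \<open>Gaps \<open>v\<close> and \<open>2m - 1\<close> are the retracts of the
          neighbours \<open>2m\<close> and \<open>2m + 1\<close>, which only a chord ending at
          \<open>2m + 1\<close> separates, and \<open>K\<close> has none.\<close>
        have "\<rho> (2 * m) = v" "\<rho> (2 * m + 1) = 2 * m - 1" by (auto simp: gap_retract_def)
        moreover have "(2 * m, 2 * m + 1) \<in> joined (Suc m) {c \<in> K. c \<subseteq> C}"
        proof -
          have "\<not> separates c (2 * m) (2 * m + 1)" if "c \<in> K" for c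
            using that by (rule K_chord) (auto simp: separates_pair)
          then show ?thesis by (simp add: joined_iff)
        qed
        ultimately show ?thesis
          using joined_K_retract[of "{c \<in> K. c \<subseteq> C}" "2 * m" "2 * m + 1"] by simp
      qed
      ultimately show ?thesis
        using curve_indet_reduced_same_curve[OF b sub] by simp
    qed
  qed
  then show ?thesis
    unfolding pairing_def prod.reindex_bij_betw[OF bij, symmetric]
    by (intro prod.cong refl arg_cong[where f = var])
qed

end

section \<open>Splitting off the smaller determinant\<close>

lemma pairing_add_cap:
  assumes m: "m > 0" and b': "b' \<in> diagrams (Suc m)"
  shows "\<exists>b''\<in>diagrams m. \<exists>f. \<forall>b\<in>diagrams m. pairing (Suc m) (add_cap m b) b' = f * pairing m b b''"
proof (cases "cap m \<in> chords b'")
  case True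
  then show ?thesis using pairing_cap[OF m b'] by blast
next
  case False
  have M: "noncrossing_matching (Suc m) (chords b')" using diagramsD(1)[OF b'] .
  obtain u where u: "{2 * m, u} \<in> chords b'" "u < 2 * Suc m" "u \<noteq> 2 * m"
    by (rule noncrossing_matching_ex_chord[OF M, of "2 * m"]) simp
  obtain v where v: "{2 * m + 1, v} \<in> chords b'" "v < 2 * Suc m" "v \<noteq> 2 * m + 1"
    by (rule noncrossing_matching_ex_chord[OF M, of "2 * m + 1"]) simp
  have "u \<noteq> 2 * m + 1" "v \<noteq> 2 * m"
    using u v False by (auto simp: cap_def insert_commute)
  then have less: "u < 2 * m" "v < 2 * m" using u v by auto
  have chords: "{u, 2 * m} \<in> chords b'" "{v, 2 * m + 1} \<in> chords b'"
    using u v by (auto simp: insert_commute)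
  moreover have "v < u"
  \<comment> \<open>Distinct chords share no end, so \<open>u\<close> and \<open>v\<close> differ;
    the order \<open>u < v < 2m < 2m + 1\<close> would be a crossing.\<close>
  proof -
    have "{u, 2 * m} \<noteq> {v, 2 * m + 1}" using less by (auto simp: doubleton_eq_iff)
    then have "u \<noteq> v" using noncrossing_matching_unique[OF M chords, of u] by auto
    moreover have "\<not> u < v"
      using noncrossing_matching_no_crossing[OF M chords] less by auto
    ultimately show ?thesis by simp
  qed
  ultimately interpret uncapped m u v b'
    using m b' less by unfold_locales auto
  have "\<forall>b\<in>diagrams m. pairing (Suc m) (add_cap m b) b' = 1 * pairing m b reduced"
    using pairing_uncapped by simp
  then show ?thesis using reduced_in_diagrams by blast
qed

theorem theorem5p1:
  fixes n :: nat and bs cs :: "diagram list"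
  assumes "n > 1"
    and "is_ordering (n - 1) bs"
    and "is_ordering n cs"
  shows "det (gram (n - 1) bs) dvd det (gram n cs)"
proof -
  define m where "m = n - 1"
  have m: "m > 0" and n: "n = Suc m" using assms(1) by (auto simp: m_def)
  have bs: "distinct bs" "set bs = diagrams m" and cs: "distinct cs" "set cs = diagrams (Suc m)"
    using assms(2,3) by (auto simp: is_ordering_def n)
  let ?k = "length bs" and ?N = "length cs"
  have "\<exists>i. i < ?N \<and> cs ! i = add_cap m (bs ! j)" if "j < ?k" for j
    using add_cap_in_diagrams[OF m, of "bs ! j"] bs(2) cs(2) that by (metis in_set_conv_nth nth_mem)
  then obtain r where r: "\<And>j. j < ?k \<Longrightarrow> r j < ?N \<and> cs ! r j = add_cap m (bs ! j)"
    by metis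
  have "\<exists>i f. i < ?k \<and> (\<forall>b\<in>diagrams m. pairing (Suc m) (add_cap m b) (cs ! j) = f * pairing m b (bs ! i))"
    if "j < ?N" for j
    using pairing_add_cap[OF m, of "cs ! j"] bs(2) cs(2) that by (metis in_set_conv_nth nth_mem)
  then obtain s f where sf: "\<And>j. j < ?N \<Longrightarrow> s j < ?k \<and>
      (\<forall>b\<in>diagrams m. pairing (Suc m) (add_cap m b) (cs ! j) = f j * pairing m b (bs ! s j))"
    by metis
  \<comment> \<open>Each column of the selected rows is a multiple of one column of the smaller Gram
    matrix, so a single entry per column, the factor placed at the index of the reduced diagram, is
    enough.\<close>
  define P where "P = mat ?k ?N (\<lambda>(i, j). if i = s j then f j else 0)"
  have "det (gram m bs) dvd det (gram (Suc m) cs)"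
  proof (rule det_dvd_det_if_rows_factor)
    show "gram (Suc m) cs \<in> carrier_mat ?N ?N" "gram m bs \<in> carrier_mat ?k ?k" "P \<in> carrier_mat ?k ?N"
      by (auto simp: gram_def P_def)
    show "inj_on r {..<?k}"
    proof (rule inj_onI)
      fix i j assume ij: "i \<in> {..<?k}" "j \<in> {..<?k}" "r i = r j"
      then have "add_cap m (bs ! i) = add_cap m (bs ! j)" using r by (metis lessThan_iff)
      moreover have "bs ! i \<in> diagrams m" "bs ! j \<in> diagrams m"
        using ij bs(2) nth_mem by auto
      ultimately have "bs ! i = bs ! j"
        by (rule inj_onD[OF inj_on_add_cap[OF m]])
      then show "i = j" using bs(1) ij by (simp add: nth_eq_iff_index_eq)
    qed
    show "r ` {..<?k} \<subseteq> {..<?N}" using r by auto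
    fix i j assume i: "i < ?k" and j: "j < ?N"
    have "gram (Suc m) cs $$ (r i, j) = pairing (Suc m) (add_cap m (bs ! i)) (cs ! j)"
      using r[OF i] j by (simp add: gram_def)
    also have "\<dots> = f j * pairing m (bs ! i) (bs ! s j)"
      using sf[OF j] bs(2) i nth_mem by blast
    also have "\<dots> = (\<Sum>l<?k. if l = s j then f j * pairing m (bs ! i) (bs ! l) else 0)"
      using sf[OF j] by (simp add: sum.delta)
    also have "\<dots> = (\<Sum>l<?k. gram m bs $$ (i, l) * P $$ (l, j))"
      using i j by (intro sum.cong) (auto simp: gram_def P_def mult.commute)
    also have "\<dots> = (gram m bs * P) $$ (i, j)"
      using i j by (simp add: scalar_prod_def gram_def P_def atLeast0LessThan)
    finally show "gram (Suc m) cs $$ (r i, j) = (gram m bs * P) $$ (i, j)" .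
  qed
  then show ?thesis by (simp add: n)
qed

end
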